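(* (1) (Monotonicity) Suppose that $r$ is increasing in $s$, $p$ is increasing in $s$, and $\Gamma(s_1)\subseteq\Gamma(s_2)$ whenever $s_1\le s_2$. Then the value function $V$ is increasing. (2) (Concavity) Suppose that $p$ is concave, $r$ is concave, $S$ is convex, and the correspondence $\Gamma$ is convex. Then $V$ is concave. In addition, if $r$ is strictly concave in $a$, then there is a unique optimal (stationary) policy function.
   Context: Discounted dynamic programming model (infinite horizon). $S\subseteq\mathbb{R}^n$ (states, a separable complete metric space) and $A\subseteq\mathbb{R}^k$ (actions) are measurable (measurable means Borel), ordered by the product order: $x\ge y$ iff $x_i\ge y_i$ for all $i$. $\Gamma:S\to2^A$ gives the feasible actions. $p(s,a,\cdot)$ is a probability measure on $S$ for each $(s,a)\in S\times A$, with $p(\cdot,\cdot,B)$ measurable for each Borel $B$. $r:S\times A\to\mathbb{R}$ is the measurable payoff and $\beta\in(0,1)$ the discount factor. Strategies: $\sigma=(\sigma_t)_{t\ge1}$ with $\sigma_t:S\times(A\times S)^{t-1}\to A$ Borel measurable and $\sigma_t(s(1),a(1),\dots,s(t))\in\Gamma(s(t))$. With initial state $s(1)=s$, $V_\sigma(s)=\mathbb{E}_\sigma\sum_{t=1}^\infty\beta^{t-1}r(s(t),a(t))$, where $\mathbb{E}_\sigma$ is the expectation for the process generated by $\sigma$ and $p$; the value function is $V(s)=\sup_\sigma V_\sigma(s)$. A (stationary) policy function is a measurable $\lambda:S\to A$ with $\lambda(s)\in\Gamma(s)$ for all $s$, used at every period; it is optimal if its payoff equals $V(s)$ for all $s$.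 Standing assumptions: $r$ is bounded and u.s.c. (upper semi-continuous); $p$ is u.s.c., i.e., $(s,a)\mapsto\int f(s')p(s,a,ds')$ is u.s.c. and bounded whenever $f:S\to\mathbb{R}$ is u.s.c. and bounded; $\Gamma$ is u.s.c., i.e., $\{s:\Gamma(s)\subseteq U\}$ is open whenever $U\subseteq A$ is open; $\Gamma(s)$ is nonempty and compact for each $s$. (Under these, $V$ is the unique bounded u.s.c. solution of $V(s)=\max_{a\in\Gamma(s)}[r(s,a)+\beta\int V(s')p(s,a,ds')]$ and an optimal stationary policy exists.) Definitions: $f$ is increasing if $x\ge y$ implies $f(x)\ge f(y)$. $p$ is increasing in $s$ if $g(s,a)=\int f(s')p(s,a,ds')$ is increasing in $s$ whenever $f:S\to\mathbb{R}$ is increasing (measurable, integrals defined). $p$ is concave if $g$ is concave in $(s,a)$ whenever $f$ is concave (measurable, integrals defined). "$r$ is concave" means jointly concave in $(s,a)$; concavity in $(s,a)$ presupposes that $A$ is convex. $\Gamma$ is convex if $a_1\in\Gamma(s_1)$, $a_2\in\Gamma(s_2)$ and $\lambda\in(0,1)$ imply $\lambda a_1+(1-\lambda)a_2\in\Gamma(\lambda s_1+(1-\lambda)s_2)$. *)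

theory Defs
  imports "HOL-Probability.Probability"
begin

section \<open>Discounted dynamic programming\<close>

definition usc_on :: "'a::topological_space set \<Rightarrow> ('a \<Rightarrow> real) \<Rightarrow> bool" where
  "usc_on X f \<longleftrightarrow> (\<forall>c. openin (top_of_set X) {x \<in> X. f x < c})"

definition strictly_concave_on :: "'a::real_vector set \<Rightarrow> ('a \<Rightarrow> real) \<Rightarrow> bool" where
  "strictly_concave_on X f \<longleftrightarrow> convex X \<and>
     (\<forall>x\<in>X. \<forall>y\<in>X. \<forall>u>0. \<forall>v>0. x \<noteq> y \<longrightarrow> u + v = 1 \<longrightarrow>
        u * f x + v * f y < f (u *\<^sub>R x + v *\<^sub>R y))"

abbreviation borel_on :: "'a::topological_space set \<Rightarrow> 'a measure" where
  "borel_on X \<equiv> restrict_space borel X"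

text \<open>
  Complete metrizability of the relative topology of \<open>S\<close> covers both a complete Euclidean
  metric (\<open>S\<close> closed) and a complete equivalent metric (for instance \<open>S\<close> open); separability
  is automatic for subsets of a Euclidean space. The kernel condition says that each \<open>p s a\<close>
  is a probability measure on the Borel sets of \<open>S\<close> and that \<open>(s, a) \<mapsto> p s a B\<close> is measurable
  for every Borel set \<open>B\<close> of \<open>S\<close>.
\<close>
definition discounted_dp ::
  "(real^'n) set \<Rightarrow> (real^'k) set \<Rightarrow> (real^'n \<Rightarrow> (real^'k) set) \<Rightarrow>
   (real^'n \<Rightarrow> real^'k \<Rightarrow> (real^'n) measure) \<Rightarrow> (real^'n \<Rightarrow> real^'k \<Rightarrow> real) \<Rightarrow> real \<Rightarrow> bool" where
  "discounted_dp S A \<Gamma> p r \<beta> \<longleftrightarrow>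
     S \<in> sets borel \<and> completely_metrizable_space (top_of_set S) \<and> A \<in> sets borel \<and>
     0 < \<beta> \<and> \<beta> < 1 \<and>
     case_prod r \<in> borel_measurable (borel_on S \<Otimes>\<^sub>M borel_on A) \<and>
     bounded (case_prod r ` (S \<times> A)) \<and>
     usc_on (S \<times> A) (case_prod r) \<and>
     case_prod p \<in> borel_on S \<Otimes>\<^sub>M borel_on A \<rightarrow>\<^sub>M prob_algebra (borel_on S) \<and>
     (\<forall>f. usc_on S f \<and> bounded (f ` S) \<longrightarrow>
        usc_on (S \<times> A) (\<lambda>(s, a). \<integral>s'. f s' \<partial>p s a) \<and>
        bounded ((\<lambda>(s, a). \<integral>s'. f s' \<partial>p s a) ` (S \<times> A))) \<and>
     (\<forall>s\<in>S. \<Gamma> s \<subseteq> A \<and> \<Gamma> s \<noteq> {} \<and> compact (\<Gamma> s)) \<and>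
     (\<forall>U. openin (top_of_set A) U \<longrightarrow> openin (top_of_set S) {s \<in> S. \<Gamma> s \<subseteq> U})"

text \<open>
  Periods are numbered from \<open>0\<close>. A decision in period \<open>t\<close> depends on a pair \<open>(h, s)\<close>: the history
  \<open>h\<close> maps each earlier period \<open>i < t\<close> to the pair (state, action) of that period, and \<open>s\<close> is the
  current state. This is \<open>(S \<times> A)\<^sup>t \<times> S\<close>, a reordering of the factors of \<open>S \<times> (A \<times> S)\<^sup>t\<close>.
\<close>
type_synonym ('s, 'a) strategy = "nat \<Rightarrow> (nat \<Rightarrow> 's \<times> 'a) \<times> 's \<Rightarrow> 'a"

definition strategies ::
  "(real^'n) set \<Rightarrow> (real^'k) set \<Rightarrow> (real^'n \<Rightarrow> (real^'k) set) \<Rightarrow> (real^'n, real^'k) strategy set" where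
  "strategies S A \<Gamma> = {\<sigma>. \<forall>t.
     \<sigma> t \<in> (\<Pi>\<^sub>M i\<in>{0..<t}. borel_on S \<Otimes>\<^sub>M borel_on A) \<Otimes>\<^sub>M borel_on S \<rightarrow>\<^sub>M borel_on A \<and>
     (\<forall>h \<in> {0..<t} \<rightarrow>\<^sub>E S \<times> A. \<forall>s\<in>S. \<sigma> t (h, s) \<in> \<Gamma> s)}"

text \<open>Conditional law of the pair (state, action) of period \<open>t\<close> given the history \<open>h\<close>.\<close>
definition transition ::
  "(real^'n) set \<Rightarrow> (real^'k) set \<Rightarrow> (real^'n \<Rightarrow> real^'k \<Rightarrow> (real^'n) measure) \<Rightarrow>
   (real^'n, real^'k) strategy \<Rightarrow> real^'n \<Rightarrow> nat \<Rightarrow> (nat \<Rightarrow> (real^'n) \<times> (real^'k)) \<Rightarrow>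
   ((real^'n) \<times> (real^'k)) measure" where
  "transition S A p \<sigma> s\<^sub>0 t h =
     distr (if t = 0 then return (borel_on S) s\<^sub>0 else case_prod p (h (t - 1)))
       (borel_on S \<Otimes>\<^sub>M borel_on A) (\<lambda>s. (s, \<sigma> t (h, s)))"

text \<open>Law of the whole process started in \<open>s\<^sub>0\<close>, by the Ionescu-Tulcea construction.\<close>
definition process ::
  "(real^'n) set \<Rightarrow> (real^'k) set \<Rightarrow> (real^'n \<Rightarrow> real^'k \<Rightarrow> (real^'n) measure) \<Rightarrow>
   (real^'n, real^'k) strategy \<Rightarrow> real^'n \<Rightarrow> (nat \<Rightarrow> (real^'n) \<times> (real^'k)) measure" where
  "process S A p \<sigma> s\<^sub>0 =
     (let M = (\<lambda>_. borel_on S \<Otimes>\<^sub>M borel_on A)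
      in projective_family.lim UNIV (Ionescu_Tulcea.CI (transition S A p \<sigma> s\<^sub>0) M) M)"

definition payoff ::
  "(real^'n) set \<Rightarrow> (real^'k) set \<Rightarrow> (real^'n \<Rightarrow> real^'k \<Rightarrow> (real^'n) measure) \<Rightarrow>
   (real^'n \<Rightarrow> real^'k \<Rightarrow> real) \<Rightarrow> real \<Rightarrow> (real^'n, real^'k) strategy \<Rightarrow> real^'n \<Rightarrow> real" where
  "payoff S A p r \<beta> \<sigma> s = (\<integral>\<omega>. (\<Sum>t. \<beta> ^ t * case_prod r (\<omega> t)) \<partial>process S A p \<sigma> s)"

definition value_function ::
  "(real^'n) set \<Rightarrow> (real^'k) set \<Rightarrow> (real^'n \<Rightarrow> (real^'k) set) \<Rightarrow>
   (real^'n \<Rightarrow> real^'k \<Rightarrow> (real^'n) measure) \<Rightarrow> (real^'n \<Rightarrow> real^'k \<Rightarrow> real) \<Rightarrow> real \<Rightarrow> real^'n \<Rightarrow> real" where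
  "value_function S A \<Gamma> p r \<beta> s = (SUP \<sigma>\<in>strategies S A \<Gamma>. payoff S A p r \<beta> \<sigma> s)"

text \<open>Policies are functions on \<open>S\<close>; extensionality makes their HOL representation unique.\<close>
definition policies ::
  "(real^'n) set \<Rightarrow> (real^'k) set \<Rightarrow> (real^'n \<Rightarrow> (real^'k) set) \<Rightarrow> (real^'n \<Rightarrow> real^'k) set" where
  "policies S A \<Gamma> = {d \<in> extensional S. d \<in> borel_on S \<rightarrow>\<^sub>M borel_on A \<and> (\<forall>s\<in>S. d s \<in> \<Gamma> s)}"

definition optimal_policy ::
  "(real^'n) set \<Rightarrow> (real^'k) set \<Rightarrow> (real^'n \<Rightarrow> (real^'k) set) \<Rightarrow>
   (real^'n \<Rightarrow> real^'k \<Rightarrow> (real^'n) measure) \<Rightarrow> (real^'n \<Rightarrow> real^'k \<Rightarrow> real) \<Rightarrow> real \<Rightarrow>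
   (real^'n \<Rightarrow> real^'k) \<Rightarrow> bool" where
  "optimal_policy S A \<Gamma> p r \<beta> d \<longleftrightarrow> d \<in> policies S A \<Gamma> \<and>
     (\<forall>s\<in>S. payoff S A p r \<beta> (\<lambda>t (h, s'). d s') s = value_function S A \<Gamma> p r \<beta> s)"

text \<open>
  The order on \<open>real^'n\<close> is the componentwise one. In the next two definitions the test functions
  are those whose integrals are finite for every state and action.
\<close>
definition kernel_increasing ::
  "(real^'n) set \<Rightarrow> (real^'k) set \<Rightarrow> (real^'n \<Rightarrow> real^'k \<Rightarrow> (real^'n) measure) \<Rightarrow> bool" where
  "kernel_increasing S A p \<longleftrightarrow>
     (\<forall>f :: real^'n \<Rightarrow> real. f \<in> borel_measurable (borel_on S) \<and> (\<forall>s\<in>S. \<forall>a\<in>A. integrable (p s a) f) \<and> mono_on S f \<longrightarrow>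
        (\<forall>a\<in>A. mono_on S (\<lambda>s. \<integral>s'. f s' \<partial>p s a)))"

definition kernel_concave ::
  "(real^'n) set \<Rightarrow> (real^'k) set \<Rightarrow> (real^'n \<Rightarrow> real^'k \<Rightarrow> (real^'n) measure) \<Rightarrow> bool" where
  "kernel_concave S A p \<longleftrightarrow>
     (\<forall>f :: real^'n \<Rightarrow> real. f \<in> borel_measurable (borel_on S) \<and> (\<forall>s\<in>S. \<forall>a\<in>A. integrable (p s a) f) \<and> concave_on S f \<longrightarrow>
        concave_on (S \<times> A) (\<lambda>(s, a). \<integral>s'. f s' \<partial>p s a))"

definition convex_correspondence ::
  "(real^'n) set \<Rightarrow> (real^'n \<Rightarrow> (real^'k) set) \<Rightarrow> bool" where
  "convex_correspondence S \<Gamma> \<longleftrightarrow>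
     (\<forall>s\<^sub>1\<in>S. \<forall>s\<^sub>2\<in>S. \<forall>a\<^sub>1\<in>\<Gamma> s\<^sub>1. \<forall>a\<^sub>2\<in>\<Gamma> s\<^sub>2. \<forall>l. 0 < l \<and> l < 1 \<longrightarrow>
        l *\<^sub>R a\<^sub>1 + (1 - l) *\<^sub>R a\<^sub>2 \<in> \<Gamma> (l *\<^sub>R s\<^sub>1 + (1 - l) *\<^sub>R s\<^sub>2))"

end

theory Submission
  imports Defs
begin

text \<open>
  The Bellman operator \<open>v \<mapsto> (\<lambda>s. max\<^bsub>a \<in> \<Gamma> s\<^esub> r s a + \<beta> \<integral>v dp)\<close> is a contraction that preserves bounded upper
  semicontinuous functions, so its iterates from \<open>0\<close> converge uniformly to a fixed point. For this
  fixed point \<open>v\<close> and every strategy the payoff equals \<open>v\<close> minus the discounted expected losses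
  \<open>v s\<^sub>t - (r s\<^sub>t a\<^sub>t + \<beta> \<integral>v dp)\<close>, which are nonnegative. A measurable selection from the maximizers has zero
  loss, hence \<open>v\<close> is the value function and a policy is optimal iff it selects maximizers
  everywhere. Monotonicity and concavity are preserved by the operator and by pointwise limits; strict
  concavity makes the maximizer unique.
\<close>

section \<open>Upper semicontinuity and measurable selection\<close>

text \<open>Strategies may depend on the whole history, so the comparison with the fixed point uses
  no shift or restart of the process: it needs only the conditional law of one coordinate given the
  preceding ones. The losses are nonnegative only on feasible pairs, so positivity has to be argued
  along the strategy. Contraction makes the convergence of the iterates uniform, which upper
  semicontinuity needs in order to pass to the limit, while monotonicity and concavity are weak
  inequalities and need only pointwise limits. A Borel choice of maximizers is built from
  compactness, through the states whose maximizers meet a given closed set. Optimality is demanded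
  from every initial state, so the loss in period 0 already forces a maximizer at each state, not
  merely almost everywhere; with extensional policies, unique maximizers then give a unique
  policy.\<close>

lemma usc_onD: "usc_on X f \<Longrightarrow> openin (top_of_set X) {x \<in> X. f x < c}"
  by (simp add: usc_on_def)

lemma usc_on_borel_measurable:
  assumes "usc_on X f"
  shows "f \<in> borel_measurable (borel_on X)"
  unfolding borel_measurable_iff_less
proof
  fix c
  obtain T where "open T" "{x \<in> X. f x < c} = X \<inter> T"
    using usc_onD[OF assms] by (auto simp: openin_open)
  then show "{x \<in> space (borel_on X). f x < c} \<in> sets (borel_on X)"
    by (auto simp: space_restrict_space sets_restrict_space)
qed

lemma usc_on_compose:
  assumes "usc_on Y f" "continuous_on X g" "g \<in> X \<rightarrow> Y"
  shows "usc_on X (\<lambda>x. f (g x))"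
  unfolding usc_on_def
proof
  fix c
  have "openin (top_of_set X) (X \<inter> g -` {y \<in> Y. f y < c})"
    using continuous_openin_preimage[OF assms(2,3) usc_onD[OF assms(1)]] .
  moreover have "X \<inter> g -` {y \<in> Y. f y < c} = {x \<in> X. f (g x) < c}"
    using assms(3) by auto
  ultimately show "openin (top_of_set X) {x \<in> X. f (g x) < c}"
    by simp
qed

lemma usc_on_subset: "usc_on X f \<Longrightarrow> Y \<subseteq> X \<Longrightarrow> usc_on Y f"
  using usc_on_compose[of X f Y "\<lambda>x. x"] by auto

text \<open>A strict inequality for the sum splits at a real threshold strictly between
  \<open>f x\<close> and \<open>c - g x\<close>; the midpoint is one.\<close>

lemma usc_on_add:
  assumes "usc_on X f" "usc_on X g"
  shows "usc_on X (\<lambda>x. f x + g x)"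
  unfolding usc_on_def
proof
  fix c
  have "{x \<in> X. f x + g x < c} = (\<Union>q. {x \<in> X. f x < q} \<inter> {x \<in> X. g x < c - q})"
  proof safe
    fix x assume "x \<in> X" "f x + g x < c"
    then show "x \<in> (\<Union>q. {x \<in> X. f x < q} \<inter> {x \<in> X. g x < c - q})"
      by (intro UN_I[of "(f x + (c - g x)) / 2"]) (auto simp: field_simps)
  qed auto
  then show "openin (top_of_set X) {x \<in> X. f x + g x < c}"
    using assms by (auto intro!: openin_Union openin_Int usc_onD)
qed

lemma usc_on_cmult:
  assumes "usc_on X f" "0 < (k::real)"
  shows "usc_on X (\<lambda>x. k * f x)"
  unfolding usc_on_def
proof
  fix c
  have "{x \<in> X. k * f x < c} = {x \<in> X. f x < c / k}"
    using \<open>0 < k\<close> by (auto simp: field_simps)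
  then show "openin (top_of_set X) {x \<in> X. k * f x < c}"
    using usc_onD[OF assms(1)] by simp
qed

lemma usc_on_const: "usc_on X (\<lambda>_. k)"
proof -
  have "{x \<in> X. k < c} = (if k < c then X else {})" for c
    by auto
  then show ?thesis
    by (simp add: usc_on_def)
qed

text \<open>The set where \<open>g\<close> lies below \<open>c\<close> is a union of open sets:
  whenever \<open>f n\<close> is uniformly within \<open>e\<close> of \<open>g\<close>, the bound
  \<open>f n x < c - e\<close> implies \<open>g x < c\<close>.\<close>

lemma usc_on_uniform_limit:
  assumes "\<And>n. usc_on X (f n)" "uniform_limit X f g sequentially"
  shows "usc_on X g"
  unfolding usc_on_def
proof
  fix c
  define I where "I = {(n, e). \<forall>x\<in>X. \<bar>f n x - g x\<bar> < e}"
  have "{x \<in> X. g x < c} = (\<Union>(n, e)\<in>I. {x \<in> X. f n x < c - e})"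
  proof safe
    fix x assume x: "x \<in> X" "g x < c"
    \<comment> \<open>With a third of the gap, closeness \<open>e\<close> gives
      \<open>f n x < g x + e = c - 2 * e\<close>, which leaves room below the required
      \<open>c - e\<close>.\<close>
    define e where "e = (c - g x) / 3"
    have "e > 0" "3 * e = c - g x" using x by (simp_all add: e_def)
    then obtain n where n: "\<And>x. x \<in> X \<Longrightarrow> \<bar>f n x - g x\<bar> < e"
      using assms(2) unfolding uniform_limit_iff dist_real_def eventually_sequentially by blast
    have "f n x < c - e"
      using n[OF x(1)] x(2) \<open>3 * e = c - g x\<close> by (simp add: abs_less_iff)
    then show "x \<in> (\<Union>(n, e)\<in>I. {x \<in> X. f n x < c - e})"
      using n x by (auto simp: I_def intro!: exI[of _ n] exI[of _ e])
  next
    fix x n e assume "(n, e) \<in> I" "x \<in> X" "f n x < c - e"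
    then show "g x < c" unfolding I_def by (auto dest!: bspec[of _ _ x])
  qed
  then show "openin (top_of_set X) {x \<in> X. g x < c}"
    using assms(1) by (auto intro!: openin_Union usc_onD)
qed

text \<open>Without a maximum, the open sets \<open>{x \<in> K. f x < f y}\<close> would cover
  \<open>K\<close>. A point of largest value among the finitely many \<open>y\<close> of a subcover
  would then be missed by the subcover.\<close>

lemma usc_on_compact_attains_sup:
  assumes "usc_on K f" "compact K" "K \<noteq> {}"
  shows "\<exists>x\<in>K. \<forall>y\<in>K. f y \<le> f x"
proof (rule ccontr)
  assume *: "\<not> ?thesis"
  let ?C = "(\<lambda>y. {x \<in> K. f x < f y}) ` K"
  have "K \<subseteq> \<Union>?C" "\<And>c. c \<in> ?C \<Longrightarrow> openin (top_of_set K) c"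
    using * usc_onD[OF assms(1)] by (auto simp: not_le)
  moreover have "(\<forall>c\<in>?C. openin (top_of_set K) c) \<and> K \<subseteq> \<Union>?C \<longrightarrow> (\<exists>D\<subseteq>?C. finite D \<and> K \<subseteq> \<Union>D)"
    using \<open>compact K\<close> unfolding compact_eq_openin_cover by (rule spec)
  ultimately obtain C where C: "C \<subseteq> ?C" "finite C" "K \<subseteq> \<Union>C"
    by blast
  obtain F where F: "F \<subseteq> K" "finite F" "C = (\<lambda>y. {x \<in> K. f x < f y}) ` F"
    using finite_subset_image[OF C(2,1)] by blast
  then have "F \<noteq> {}"
    using \<open>K \<noteq> {}\<close> C(3) by auto
  have "Max (f ` F) \<in> f ` F"
    using F \<open>F \<noteq> {}\<close> by (intro Max_in) auto
  then obtain y where y: "y \<in> F" "f y = Max (f ` F)"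
    by auto
  then obtain z where "z \<in> F" "f y < f z"
    using F C(3) by auto
  moreover from this have "f z \<le> Max (f ` F)"
    using F(2) by (intro Max_ge) auto
  ultimately show False
    using y(2) by simp
qed

text \<open>A tube argument with varying fibres: compactness of
  \<open>{s} \<times> \<Gamma> s\<close> gives a box \<open>U \<times> V\<close> inside
  \<open>W\<close>, and upper semicontinuity keeps the fibres of nearby states in
  \<open>V\<close>.\<close>

lemma openin_usc_correspondence:
  fixes \<Gamma> :: "'a::topological_space \<Rightarrow> 'b::topological_space set"
  assumes usc: "\<And>U. openin (top_of_set A) U \<Longrightarrow> openin (top_of_set S) {s \<in> S. \<Gamma> s \<subseteq> U}"
    and \<Gamma>: "\<And>s. s \<in> S \<Longrightarrow> compact (\<Gamma> s)" "\<And>s. s \<in> S \<Longrightarrow> \<Gamma> s \<subseteq> A"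
    and W: "openin (top_of_set (S \<times> A)) W"
  shows "openin (top_of_set S) {s \<in> S. {s} \<times> \<Gamma> s \<subseteq> W}"
proof (subst openin_subopen, safe)
  fix s assume s: "s \<in> S" "{s} \<times> \<Gamma> s \<subseteq> W"
  have "openin (prod_topology (top_of_set S) (top_of_set A)) W"
    using W by (simp add: subtopology_Times euclidean_product_topology flip: prod_topology_subtopology)
  moreover have "compactin (top_of_set S) {s}" "compactin (top_of_set A) (\<Gamma> s)"
    using s \<Gamma> by (auto simp: compactin_subtopology)
  ultimately obtain U V where UV: "openin (top_of_set S) U" "openin (top_of_set A) V"
    "{s} \<subseteq> U" "\<Gamma> s \<subseteq> V" "U \<times> V \<subseteq> W"
    using s(2) Wallace_theorem_prod_topology by metis
  show "\<exists>T. openin (top_of_set S) T \<and> s \<in> T \<and> T \<subseteq> {s \<in> S. {s} \<times> \<Gamma> s \<subseteq> W}"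
    using UV s by (intro exI[of _ "U \<inter> {s \<in> S. \<Gamma> s \<subseteq> V}"]) (auto intro!: openin_Int usc)
qed

section \<open>Measurable selection from compact sets\<close>

text \<open>One stage of a lexicographic minimization, where \<open>b\<close> will be a basis
  vector. The minimum \<open>m\<close> is Borel since \<open>m s \<le> c\<close> means that
  \<open>D s\<close> meets a closed half-space. The minimizers meet \<open>F\<close> iff
  \<open>D s\<close> meets \<open>F\<close> within every half-space
  \<open>x \<bullet> b \<le> q\<close> with rational \<open>q > m s\<close>; compactness turns these
  approximate minimizers in \<open>F\<close> into an exact one.\<close>

lemma compact_selection_step:
  fixes D :: "'s \<Rightarrow> 'a::euclidean_space set" and b :: 'a
  assumes D: "\<And>s. s \<in> space N \<Longrightarrow> compact (D s)" "\<And>s. s \<in> space N \<Longrightarrow> D s \<noteq> {}"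
    and meas: "\<And>F. closed F \<Longrightarrow> {s \<in> space N. D s \<inter> F \<noteq> {}} \<in> sets N"
  defines "E \<equiv> \<lambda>s. {x \<in> D s. \<forall>y\<in>D s. x \<bullet> b \<le> y \<bullet> b}"
  shows "s \<in> space N \<Longrightarrow> compact (E s)" "s \<in> space N \<Longrightarrow> E s \<noteq> {}"
    and "closed F \<Longrightarrow> {s \<in> space N. E s \<inter> F \<noteq> {}} \<in> sets N"
proof -
  have min: "\<exists>x\<in>K. \<forall>y\<in>K. x \<bullet> b \<le> y \<bullet> b" if "compact K" "K \<noteq> {}" for K
    using that by (intro continuous_attains_inf) (auto intro!: continuous_intros)
  have closed_le: "closed {x. x \<bullet> b \<le> c}" for c
    by (intro closed_Collect_le continuous_intros)
  show "E s \<noteq> {}" if "s \<in> space N" for s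
    using min[OF D[OF that]] by (auto simp: E_def)
  show "compact (E s)" if s: "s \<in> space N" for s
  proof -
    obtain x where x: "x \<in> D s" "\<And>y. y \<in> D s \<Longrightarrow> x \<bullet> b \<le> y \<bullet> b"
      using min[OF D[OF s]] by blast
    have "y \<in> E s" if "y \<in> D s" "y \<bullet> b \<le> x \<bullet> b" for y
      using that(1) order_trans[OF that(2) x(2)] by (simp add: E_def)
    then have "E s = D s \<inter> {y. y \<bullet> b \<le> x \<bullet> b}"
      using x(1) unfolding E_def by blast
    then show ?thesis
      using compact_Int_closed[OF D(1)[OF s] closed_le] by simp
  qed
  define m where "m s = (INF x\<in>D s. x \<bullet> b)" for s
  have m: "x \<in> E s \<Longrightarrow> m s = x \<bullet> b" for x s
    unfolding m_def E_def by (rule cInf_eq_minimum) auto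
  have m_le: "m s \<le> c \<longleftrightarrow> D s \<inter> {x. x \<bullet> b \<le> c} \<noteq> {}" if s: "s \<in> space N" for s c
  proof -
    obtain x where x: "x \<in> D s" "\<And>y. y \<in> D s \<Longrightarrow> x \<bullet> b \<le> y \<bullet> b"
      using min[OF D[OF s]] by blast
    then have "m s = x \<bullet> b"
      by (intro m) (simp add: E_def)
    moreover have "x \<bullet> b \<le> c" if "y \<in> D s" "y \<bullet> b \<le> c" for y
      using order_trans[OF x(2)[OF that(1)] that(2)] .
    ultimately show ?thesis
      using x(1) by (auto simp del: not_le)
  qed
  have "{s \<in> space N. m s \<le> c} = {s \<in> space N. D s \<inter> {x. x \<bullet> b \<le> c} \<noteq> {}}" for c
    by (rule Collect_cong, rule conj_cong[OF refl m_le])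
  then have [measurable]: "m \<in> borel_measurable N"
    using meas[OF closed_le] by (simp add: borel_measurable_iff_le)
  show "{s \<in> space N. E s \<inter> F \<noteq> {}} \<in> sets N" if F: "closed F"
  proof -
    define H where "H q = {s \<in> space N. D s \<inter> (F \<inter> {x. x \<bullet> b \<le> real_of_rat q}) \<noteq> {}}" for q
    have [measurable]: "H q \<in> sets N" for q
      unfolding H_def by (intro meas closed_Int F closed_le)
    have H: "(E s \<inter> F \<noteq> {}) \<longleftrightarrow> (\<forall>q. m s < real_of_rat q \<longrightarrow> s \<in> H q)" if s: "s \<in> space N" for s
    proof
      assume "E s \<inter> F \<noteq> {}"
      then obtain x where "x \<in> E s" "x \<in> F" by auto
      then show "\<forall>q. m s < real_of_rat q \<longrightarrow> s \<in> H q"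
        using s m[of x s] by (auto simp: H_def E_def)
    next
      assume H: "\<forall>q. m s < real_of_rat q \<longrightarrow> s \<in> H q"
      obtain q where "m s < real_of_rat q"
        using of_rat_dense[of "m s" "m s + 1"] by auto
      then have "D s \<inter> F \<noteq> {}"
        using H unfolding H_def by blast
      from min[OF compact_Int_closed[OF D(1)[OF s] F] this]
      obtain x where x: "x \<in> D s \<inter> F" "\<And>y. y \<in> D s \<inter> F \<Longrightarrow> x \<bullet> b \<le> y \<bullet> b"
        by blast
      \<comment> \<open>\<open>x\<close> minimizes over \<open>D s \<inter> F\<close>; if its value
        exceeded \<open>m s\<close>, a rational strictly between would supply a point of
        \<open>D s \<inter> F\<close> below it.\<close>
      have "x \<bullet> b \<le> m s"
      proof (rule ccontr)
        assume "\<not> x \<bullet> b \<le> m s"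
        then obtain q where "m s < real_of_rat q" "real_of_rat q < x \<bullet> b"
          using of_rat_dense[of "m s" "x \<bullet> b"] by auto
        moreover from this obtain y where "y \<in> D s \<inter> F" "y \<bullet> b \<le> real_of_rat q"
          using H unfolding H_def by blast
        ultimately show False
          using x(2)[of y] by simp
      qed
      moreover obtain z where "z \<in> E s"
        using min[OF D[OF s]] by (auto simp: E_def)
      ultimately have "x \<in> E s"
        using m[OF \<open>z \<in> E s\<close>] x(1) unfolding E_def by fastforce
      then show "E s \<inter> F \<noteq> {}"
        using x by auto
    qed
    have "{s \<in> space N. E s \<inter> F \<noteq> {}} = {s \<in> space N. \<forall>q. m s < real_of_rat q \<longrightarrow> s \<in> H q}"
      by (rule Collect_cong, rule conj_cong[OF refl H])
    also have "\<dots> = (\<Inter>q. {s \<in> space N. real_of_rat q \<le> m s} \<union> H q)"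
      unfolding imp_conv_disj not_less using H_def by blast
    also have "\<dots> \<in> sets N"
      by (intro sets.countable_INT sets.Un) (auto intro: borel_measurable_le)
    finally show ?thesis .
  qed
qed

text \<open>Minimizing the coordinates one after the other leaves a single point of \<open>D s\<close>.\<close>
lemma compact_measurable_selection:
  fixes D :: "'s \<Rightarrow> 'a::euclidean_space set"
  assumes D: "\<And>s. s \<in> space N \<Longrightarrow> compact (D s)" "\<And>s. s \<in> space N \<Longrightarrow> D s \<noteq> {}"
    and meas: "\<And>F. closed F \<Longrightarrow> {s \<in> space N. D s \<inter> F \<noteq> {}} \<in> sets N"
  obtains d where "d \<in> borel_measurable N" "\<And>s. s \<in> space N \<Longrightarrow> d s \<in> D s"
proof -
  \<comment> \<open>Induction invariant: measurability of the meeting sets allows the next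
    minimization, and agreement of the coordinates in \<open>B\<close> makes \<open>E s\<close> a
    single point once \<open>B\<close> is the whole basis.\<close>
  define selects where "selects B E \<longleftrightarrow>
      (\<forall>s\<in>space N. compact (E s) \<and> E s \<noteq> {} \<and> E s \<subseteq> D s \<and> (\<forall>b\<in>B. \<forall>x\<in>E s. \<forall>y\<in>E s. x \<bullet> b = y \<bullet> b)) \<and>
      (\<forall>F. closed F \<longrightarrow> {s \<in> space N. E s \<inter> F \<noteq> {}} \<in> sets N)" for B and E :: "'s \<Rightarrow> 'a set"
  have "\<exists>E. selects B E" if "finite B" for B
    using that
  proof induction
    case empty
    show ?case using D meas unfolding selects_def by (intro exI[of _ D]) auto
  next
    case (insert b B)
    from insert.IH obtain E where "selects B E"
      by blast
    then have E: "\<And>s. s \<in> space N \<Longrightarrow> compact (E s)" "\<And>s. s \<in> space N \<Longrightarrow> E s \<noteq> {}"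
      "\<And>F. closed F \<Longrightarrow> {s \<in> space N. E s \<inter> F \<noteq> {}} \<in> sets N"
      and E': "\<And>s. s \<in> space N \<Longrightarrow> E s \<subseteq> D s"
      "\<And>s b x y. s \<in> space N \<Longrightarrow> b \<in> B \<Longrightarrow> x \<in> E s \<Longrightarrow> y \<in> E s \<Longrightarrow> x \<bullet> b = y \<bullet> b"
      unfolding selects_def by blast+
    define G where "G s = {x \<in> E s. \<forall>y\<in>E s. x \<bullet> b \<le> y \<bullet> b}" for s
    have "compact (G s)" "G s \<noteq> {}" if "s \<in> space N" for s
      unfolding G_def by (rule compact_selection_step(1,2)[where N=N]; use E that in blast)+
    moreover have "G s \<subseteq> D s" if "s \<in> space N" for s
      using E'(1)[OF that] unfolding G_def by blast
    moreover have "x \<bullet> b' = y \<bullet> b'" if "s \<in> space N" "b' \<in> insert b B" "x \<in> G s" "y \<in> G s" for s b' x y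
    proof (cases "b' = b")
      case True
      then show ?thesis using that(3,4) by (intro antisym) (auto simp: G_def)
    next
      case False
      then show ?thesis using that by (intro E'(2)[of s]) (auto simp: G_def)
    qed
    moreover have "{s \<in> space N. G s \<inter> F \<noteq> {}} \<in> sets N" if "closed F" for F
      unfolding G_def by (rule compact_selection_step(3)[where N=N]; use E that in blast)
    ultimately have "selects (insert b B) G"
      unfolding selects_def by blast
    then show ?case by (rule exI[of _ G])
  qed
  from this[OF finite_Basis] obtain E where "selects Basis E"
    by blast
  then have E: "\<And>s. s \<in> space N \<Longrightarrow> E s \<noteq> {}" "\<And>s. s \<in> space N \<Longrightarrow> E s \<subseteq> D s"
      "\<And>F. closed F \<Longrightarrow> {s \<in> space N. E s \<inter> F \<noteq> {}} \<in> sets N"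
    and inner_eq: "\<And>s b x y. s \<in> space N \<Longrightarrow> b \<in> Basis \<Longrightarrow> x \<in> E s \<Longrightarrow> y \<in> E s \<Longrightarrow> x \<bullet> b = y \<bullet> b"
    unfolding selects_def by blast+
  have eq: "x = y" if "s \<in> space N" "x \<in> E s" "y \<in> E s" for s x y
    by (rule euclidean_eqI) (rule inner_eq[OF that(1) _ that(2,3)])
  define d where "d s = (SOME x. x \<in> E s)" for s
  have d: "d s \<in> E s" if "s \<in> space N" for s
    unfolding d_def using E(1)[OF that] by (simp add: some_in_eq)
  have "d \<in> borel_measurable N"
  proof (subst borel_measurable_euclidean_space, intro ballI borel_measurableI_le)
    fix b :: 'a and c
    \<comment> \<open>Since \<open>d s\<close> is the only point of \<open>E s\<close>, each
      coordinate sublevel set is the meeting set of a closed half-space.\<close>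
    have "{s \<in> space N. d s \<bullet> b \<le> c} = {s \<in> space N. E s \<inter> {x. x \<bullet> b \<le> c} \<noteq> {}}"
    proof (rule Collect_cong, rule conj_cong[OF refl])
      fix s assume "s \<in> space N"
      then show "(d s \<bullet> b \<le> c) = (E s \<inter> {x. x \<bullet> b \<le> c} \<noteq> {})"
        using d[of s] eq[of s _ "d s"] by blast
    qed
    moreover have "closed {x. x \<bullet> b \<le> c}"
      by (intro closed_Collect_le continuous_intros)
    ultimately show "{s \<in> space N. d s \<bullet> b \<le> c} \<in> sets N"
      using E(3) by simp
  qed
  then show thesis
    by (rule that) (use d E(2) in blast)
qed

section \<open>Payoffs of strategies\<close>

context Ionescu_Tulcea
begin

text \<open>\<open>CI J\<close> is the image of \<open>C 0 (up_to J)\<close> under restriction to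
  \<open>J\<close>; on an initial segment \<open>up_to\<close> is its length, so the restriction
  changes nothing.\<close>

lemma distr_lim_prefix:
  "distr PF.lim (PiM {0..<n} M) (\<lambda>x. restrict x {0..<n}) = C 0 n (\<lambda>_. undefined)"
proof -
  have "up_to {0..<n} = n"
    by (rule antisym) (use up_to_iff_Ico[of "{0..<n}" n] up_to_iff_Ico[of "{0..<n}" "up_to {0..<n}"] in auto)
  then show ?thesis
    using distr_C[of n n "\<lambda>_. undefined" 0] by (simp add: distr_lim CI_def)
qed

lemma integral_lim_prefix:
  fixes f :: "(nat \<Rightarrow> 'a) \<Rightarrow> real"
  assumes [measurable]: "f \<in> borel_measurable (PiM {0..<n} M)"
  shows "(\<integral>\<omega>. f (restrict \<omega> {0..<n}) \<partial>PF.lim) = (\<integral>h. f h \<partial>C 0 n (\<lambda>_. undefined))"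
proof -
  have "(\<lambda>x. restrict x {0..<n}) \<in> PF.lim \<rightarrow>\<^sub>M PiM {0..<n} M"
    by (auto intro!: measurable_restrict measurable_component_singleton simp: measurable_cong_sets[OF PF.sets_lim refl])
  then show ?thesis
    unfolding distr_lim_prefix[symmetric] by (subst integral_distr) auto
qed

lemma integral_eP:
  fixes f :: "(nat \<Rightarrow> 'a) \<Rightarrow> real"
  assumes "\<omega> \<in> space (PiM {0..<n} M)" "f \<in> borel_measurable (PiM {0..<Suc n} M)"
  shows "(\<integral>x. f x \<partial>eP n \<omega>) = (\<integral>x. f (fun_upd \<omega> n x) \<partial>P n \<omega>)"
  unfolding eP_def using assms
  by (subst integral_distr) (auto intro!: measurable_fun_upd[where J="{0..<n}"] simp: space_PiM PiE_iff)

text \<open>The law of the first \<open>n + 1\<close> coordinates arises from that of the first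
  \<open>n\<close> by one draw from \<open>P n\<close>, so integrating the new coordinate first
  gives a conditional expectation. The bound on \<open>f\<close> justifies the iterated integral.
  All later conditional expectations of the process rest on this formula.\<close>

lemma integral_lim_component:
  fixes f :: "'a \<Rightarrow> real"
  assumes f[measurable]: "f \<in> borel_measurable (M n)" and B: "\<And>x. x \<in> space (M n) \<Longrightarrow> \<bar>f x\<bar> \<le> B"
  shows "(\<integral>\<omega>. f (\<omega> n) \<partial>PF.lim) = (\<integral>\<omega>. (\<integral>x. f x \<partial>P n (restrict \<omega> {0..<n})) \<partial>PF.lim)"
proof -
  let ?u = "\<lambda>_. undefined"
  interpret C: prob_space "C 0 n ?u"
    by (rule prob_space_C) simp
  have sp: "space (C 0 n ?u) = space (PiM {0..<n} M)"
    using space_C[of ?u 0 n] by simp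
  have fm: "(\<lambda>h. f (h n)) \<in> borel_measurable (PiM {0..<Suc n} M)"
    by measurable
  have "(\<integral>\<omega>. f (\<omega> n) \<partial>PF.lim) = (\<integral>\<omega>. f (restrict \<omega> {0..<Suc n} n) \<partial>PF.lim)"
    by simp
  also have "\<dots> = (\<integral>h. f (h n) \<partial>C 0 (Suc n) ?u)"
    by (rule integral_lim_prefix[of "\<lambda>h. f (h n)", OF fm])
  also have "\<dots> = (\<integral>h. (\<integral>h'. f (h' n) \<partial>eP n h) \<partial>C 0 n ?u)"
    unfolding C.simps add_0
  proof (rule integral_bind[where K="PiM {0..<Suc n} M" and B'=1 and B=B])
    show "\<bar>f (x n)\<bar> \<le> B" if "x \<in> space (PiM {0..<Suc n} M)" for x
      using that by (intro B) (auto simp: space_PiM PiE_iff)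
    show "eP n \<in> C 0 n ?u \<rightarrow>\<^sub>M subprob_algebra (PiM {0..<Suc n} M)"
      using measurable_eP[of n] sets_C[of ?u 0 n] by (simp cong: measurable_cong_sets)
    show "AE x in C 0 n ?u. emeasure (eP n x) (space (eP n x)) \<le> ennreal 1"
      by (rule AE_I2) (simp add: sp prob_space.emeasure_space_1[OF prob_space_eP])
  qed (use fm C.finite_measure in auto)
  also have "\<dots> = (\<integral>h. (\<integral>x. f x \<partial>P n h) \<partial>C 0 n ?u)"
    by (rule Bochner_Integration.integral_cong) (simp_all add: sp integral_eP fm)
  also have "\<dots> = (\<integral>\<omega>. (\<integral>x. f x \<partial>P n (restrict \<omega> {0..<n})) \<partial>PF.lim)"
    by (rule integral_lim_prefix[symmetric]) measurable
  finally show ?thesis .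
qed

text \<open>Total mass is preserved by every measurable image, even by the restriction to no
  coordinates at all.\<close>

lemma prob_space_lim: "prob_space PF.lim"
proof (rule prob_space_distrD)
  show "(\<lambda>x. restrict x {0..<0}) \<in> PF.lim \<rightarrow>\<^sub>M PiM {0..<0} M"
    by (auto intro!: measurable_restrict simp: measurable_cong_sets[OF PF.sets_lim refl])
  show "prob_space (distr PF.lim (PiM {0..<0} M) (\<lambda>x. restrict x {0..<0}))"
    unfolding distr_lim_prefix by (rule prob_space_C) simp
qed

end

section \<open>The model and its one-period kernels\<close>

locale discounted =
  fixes S :: "(real^'n) set" and A :: "(real^'k) set"
    and \<Gamma> :: "real^'n \<Rightarrow> (real^'k) set"
    and p :: "real^'n \<Rightarrow> real^'k \<Rightarrow> (real^'n) measure"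
    and r :: "real^'n \<Rightarrow> real^'k \<Rightarrow> real" and \<beta> :: real
  assumes dp: "discounted_dp S A \<Gamma> p r \<beta>"
begin

abbreviation "M \<equiv> borel_on S \<Otimes>\<^sub>M borel_on A"

lemma \<beta>: "0 < \<beta>" "\<beta> < 1"
  and r_meas[measurable]: "case_prod r \<in> borel_measurable M"
  and p_meas[measurable]: "case_prod p \<in> M \<rightarrow>\<^sub>M prob_algebra (borel_on S)"
  and \<Gamma>_subset: "s \<in> S \<Longrightarrow> \<Gamma> s \<subseteq> A" and \<Gamma>_nonempty: "s \<in> S \<Longrightarrow> \<Gamma> s \<noteq> {}"
  and \<Gamma>_compact: "s \<in> S \<Longrightarrow> compact (\<Gamma> s)"
  and \<Gamma>_usc: "openin (top_of_set A) U \<Longrightarrow> openin (top_of_set S) {s \<in> S. \<Gamma> s \<subseteq> U}"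
  and r_usc: "usc_on (S \<times> A) (case_prod r)"
  and p_usc: "usc_on S f \<Longrightarrow> bounded (f ` S) \<Longrightarrow> usc_on (S \<times> A) (\<lambda>(s, a). \<integral>s'. f s' \<partial>p s a)"
  using dp unfolding discounted_dp_def by auto

definition "R = (SOME R. 0 \<le> R \<and> (\<forall>s\<in>S. \<forall>a\<in>A. \<bar>r s a\<bar> \<le> R))"

lemma R: "0 \<le> R" "s \<in> S \<Longrightarrow> a \<in> A \<Longrightarrow> \<bar>r s a\<bar> \<le> R"
proof -
  have "\<exists>R. \<forall>x\<in>S \<times> A. \<bar>case_prod r x\<bar> \<le> R"
    using dp unfolding discounted_dp_def bounded_iff by auto
  then obtain R' where "\<And>s a. s \<in> S \<Longrightarrow> a \<in> A \<Longrightarrow> \<bar>r s a\<bar> \<le> R'"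
    by auto
  then have "0 \<le> \<bar>R'\<bar> \<and> (\<forall>s\<in>S. \<forall>a\<in>A. \<bar>r s a\<bar> \<le> \<bar>R'\<bar>)"
    by force
  then have "0 \<le> R \<and> (\<forall>s\<in>S. \<forall>a\<in>A. \<bar>r s a\<bar> \<le> R)"
    unfolding R_def by (rule someI)
  then show "0 \<le> R" "s \<in> S \<Longrightarrow> a \<in> A \<Longrightarrow> \<bar>r s a\<bar> \<le> R"
    by auto
qed

lemma space_MS[simp]: "space (borel_on S) = S" and space_MA[simp]: "space (borel_on A) = A"
  by (simp_all add: space_restrict_space)

lemma space_M[simp]: "space M = S \<times> A"
  by (simp add: space_pair_measure)

lemma
  assumes "s \<in> S" "a \<in> A"
  shows prob_space_p: "prob_space (p s a)"
    and sets_p: "sets (p s a) = sets (borel_on S)"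
    and space_p: "space (p s a) = S"
proof -
  have "case_prod p (s, a) \<in> space (prob_algebra (borel_on S))"
    by (rule measurable_space[OF p_meas]) (use assms in auto)
  then show "prob_space (p s a)" and sets: "sets (p s a) = sets (borel_on S)"
    by (auto simp: space_prob_algebra)
  show "space (p s a) = S"
    using sets_eq_imp_space_eq[OF sets] by simp
qed

lemma integrable_p:
  fixes f :: "real^'n \<Rightarrow> real"
  assumes "s \<in> S" "a \<in> A" "f \<in> borel_measurable (borel_on S)" "\<And>s. s \<in> S \<Longrightarrow> \<bar>f s\<bar> \<le> B"
  shows "integrable (p s a) f"
proof -
  interpret prob_space "p s a" by (rule prob_space_p) fact+
  show ?thesis
    by (rule integrable_const_bound[where B=B])
       (use assms sets_p space_p in \<open>auto cong: measurable_cong_sets\<close>)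
qed

lemma integral_p_bound:
  fixes f :: "real^'n \<Rightarrow> real"
  assumes "s \<in> S" "a \<in> A" "f \<in> borel_measurable (borel_on S)" "\<And>s. s \<in> S \<Longrightarrow> \<bar>f s\<bar> \<le> B"
  shows "\<bar>\<integral>s'. f s' \<partial>p s a\<bar> \<le> B"
proof -
  interpret prob_space "p s a" by (rule prob_space_p) fact+
  have i: "integrable (p s a) f" by (rule integrable_p) fact+
  have "\<And>x. x \<in> S \<Longrightarrow> f x \<le> B" "\<And>x. x \<in> S \<Longrightarrow> - B \<le> f x"
    using assms(4) by (force simp: abs_le_iff)+
  then have "(\<integral>s'. f s' \<partial>p s a) \<le> (\<integral>s'. B \<partial>p s a)" "(\<integral>s'. - B \<partial>p s a) \<le> (\<integral>s'. f s' \<partial>p s a)"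
    using i assms(1,2)
    by (auto simp: space_p simp del: lebesgue_integral_const integral_minus intro!: integral_mono)
  then show ?thesis by (simp add: abs_le_iff prob_space)
qed

lemma integral_p_measurable[measurable]:
  fixes f :: "real^'n \<Rightarrow> real"
  assumes [measurable]: "f \<in> borel_measurable (borel_on S)"
  shows "(\<lambda>(s, a). \<integral>s'. f s' \<partial>p s a) \<in> borel_measurable M"
proof -
  have "(\<lambda>x. \<integral>s'. f s' \<partial>case_prod p x) \<in> borel_measurable M"
    using p_meas[THEN measurable_prob_algebraD] by measurable
  then show ?thesis by (simp add: case_prod_beta')
qed

lemma strategyD:
  assumes "\<sigma> \<in> strategies S A \<Gamma>"
  shows "\<sigma> t \<in> (\<Pi>\<^sub>M i\<in>{0..<t}. M) \<Otimes>\<^sub>M borel_on S \<rightarrow>\<^sub>M borel_on A"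
    and "h \<in> space (\<Pi>\<^sub>M i\<in>{0..<t}. M) \<Longrightarrow> s \<in> S \<Longrightarrow> \<sigma> t (h, s) \<in> \<Gamma> s"
  using assms unfolding strategies_def by (auto simp: space_PiM)

text \<open>The state is drawn from a point mass or from \<open>p\<close> at the last pair, then
  carried along \<open>s \<mapsto> (s, \<sigma> t (h, s))\<close>; joint measurability of
  \<open>\<sigma> t\<close> in history and state makes the image a kernel in
  \<open>h\<close>.\<close>

lemma transition_measurable:
  assumes \<sigma>: "\<sigma> \<in> strategies S A \<Gamma>" and s: "s\<^sub>0 \<in> S"
  shows "transition S A p \<sigma> s\<^sub>0 t \<in> (\<Pi>\<^sub>M i\<in>{0..<t}. M) \<rightarrow>\<^sub>M prob_algebra M"
proof -
  note [measurable] = strategyD(1)[OF \<sigma>, of t]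
  have K: "(\<lambda>h. if t = 0 then return (borel_on S) s\<^sub>0 else case_prod p (h (t - 1)))
     \<in> (\<Pi>\<^sub>M i\<in>{0..<t}. M) \<rightarrow>\<^sub>M prob_algebra (borel_on S)"
  proof (cases t)
    case 0
    have "return (borel_on S) s\<^sub>0 \<in> space (prob_algebra (borel_on S))"
      using s by (auto simp: space_prob_algebra intro!: prob_space_return)
    then show ?thesis using 0 by simp
  next
    case (Suc n)
    have "(\<lambda>h. h n) \<in> (\<Pi>\<^sub>M i\<in>{0..<t}. M) \<rightarrow>\<^sub>M M"
      using Suc by (intro measurable_component_singleton) auto
    from measurable_compose[OF this p_meas] show ?thesis using Suc by simp
  qed
  show ?thesis
    unfolding transition_def
    by (rule measurable_distr_prob_space2[OF K]) measurable
qed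

text \<open>\<open>process\<close> is defined from constants of the Ionescu-Tulcea locale without
  any hypothesis; this licenses the locale facts for it.\<close>

lemma Ionescu_Tulcea:
  assumes "\<sigma> \<in> strategies S A \<Gamma>" "s\<^sub>0 \<in> S"
  shows "Ionescu_Tulcea (transition S A p \<sigma> s\<^sub>0) (\<lambda>_. M)"
proof (rule Ionescu_Tulcea.intro)
  show "transition S A p \<sigma> s\<^sub>0 t \<in> (\<Pi>\<^sub>M i\<in>{0..<t}. M) \<rightarrow>\<^sub>M subprob_algebra M" for t
    using transition_measurable[OF assms] by (rule measurable_prob_algebraD)
  show "prob_space (transition S A p \<sigma> s\<^sub>0 t h)" if "h \<in> space (\<Pi>\<^sub>M i\<in>{0..<t}. M)" for t h
    using measurable_space[OF transition_measurable[OF assms] that] by (simp add: space_prob_algebra)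
qed

lemma integral_transition:
  fixes f :: "(real^'n) \<times> (real^'k) \<Rightarrow> real"
  assumes \<sigma>: "\<sigma> \<in> strategies S A \<Gamma>" and s: "s\<^sub>0 \<in> S" and h: "h \<in> space (\<Pi>\<^sub>M i\<in>{0..<t}. M)"
    and [measurable]: "f \<in> borel_measurable M"
  shows "(\<integral>x. f x \<partial>transition S A p \<sigma> s\<^sub>0 t h) =
    (\<integral>s. f (s, \<sigma> t (h, s)) \<partial>(if t = 0 then return (borel_on S) s\<^sub>0 else case_prod p (h (t - 1))))" (is "_ = integral\<^sup>L ?N _")
    and "space (if t = 0 then return (borel_on S) s\<^sub>0 else case_prod p (h (t - 1))) = S"
proof -
  note [measurable] = strategyD(1)[OF \<sigma>, of t] h
  have "t \<noteq> 0 \<Longrightarrow> h (t - 1) \<in> S \<times> A"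
    using h by (auto simp: space_PiM PiE_iff)
  then have sets[measurable_cong]: "sets ?N = sets (borel_on S)"
    by (auto simp: sets_p)
  have "(\<lambda>s. (s, \<sigma> t (h, s))) \<in> borel_on S \<rightarrow>\<^sub>M M"
    by measurable
  then have "(\<lambda>s. (s, \<sigma> t (h, s))) \<in> ?N \<rightarrow>\<^sub>M M"
    by (simp only: measurable_cong_sets[OF sets refl])
  then show "(\<integral>x. f x \<partial>transition S A p \<sigma> s\<^sub>0 t h) = (\<integral>s. f (s, \<sigma> t (h, s)) \<partial>?N)"
    unfolding transition_def by (rule integral_distr) measurable
  show "space ?N = S"
    using sets_eq_imp_space_eq[OF sets] by simp
qed

definition q_value :: "(real^'n \<Rightarrow> real) \<Rightarrow> real^'n \<Rightarrow> real^'k \<Rightarrow> real" where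
  "q_value v s a = r s a + \<beta> * (\<integral>s'. v s' \<partial>p s a)"

text \<open>The shortfall of an action against \<open>v\<close>. It can have either sign for a
  general \<open>v\<close>; for the Bellman fixed point it is nonnegative on feasible pairs and,
  among these, vanishes exactly at the maximizers.\<close>

definition loss :: "(real^'n \<Rightarrow> real) \<Rightarrow> (real^'n) \<times> (real^'k) \<Rightarrow> real" where
  "loss v x = v (fst x) - q_value v (fst x) (snd x)"

lemma q_value_measurable:
  assumes [measurable]: "v \<in> borel_measurable (borel_on S)"
  shows "case_prod (q_value v) \<in> borel_measurable M"
proof -
  have "(\<lambda>x. case_prod r x + \<beta> * (case x of (s, a) \<Rightarrow> \<integral>s'. v s' \<partial>p s a)) \<in> borel_measurable M"
    by measurable
  then show ?thesis by (simp add: q_value_def[abs_def] case_prod_beta')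
qed

lemma q_value_bound:
  assumes "v \<in> borel_measurable (borel_on S)" "\<And>s. s \<in> S \<Longrightarrow> \<bar>v s\<bar> \<le> B" "s \<in> S" "a \<in> A"
  shows "\<bar>q_value v s a\<bar> \<le> R + \<beta> * B"
proof -
  have "\<bar>\<beta> * (\<integral>s'. v s' \<partial>p s a)\<bar> \<le> \<beta> * B"
    using integral_p_bound[OF assms(3,4,1,2)] \<beta> by (simp add: abs_mult)
  then show ?thesis
    using R(2)[OF assms(3,4)] unfolding q_value_def by linarith
qed

lemma loss_measurable:
  assumes [measurable]: "v \<in> borel_measurable (borel_on S)"
  shows "loss v \<in> borel_measurable M"
proof -
  note [measurable] = q_value_measurable[OF assms]
  have "(\<lambda>x. v (fst x) - case_prod (q_value v) x) \<in> borel_measurable M"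
    by measurable
  then show ?thesis by (simp add: loss_def[abs_def] case_prod_beta')
qed

lemma loss_bound:
  assumes "v \<in> borel_measurable (borel_on S)" "\<And>s. s \<in> S \<Longrightarrow> \<bar>v s\<bar> \<le> B" "x \<in> S \<times> A"
  shows "\<bar>loss v x\<bar> \<le> B + (R + \<beta> * B)"
  using q_value_bound[OF assms(1,2), of "fst x" "snd x"] assms(2)[of "fst x"] assms(3)
  unfolding loss_def by (auto simp: mem_Times_iff)

section \<open>Expectations under a fixed strategy and initial state\<close>

context
  fixes \<sigma> s\<^sub>0
  assumes \<sigma>: "\<sigma> \<in> strategies S A \<Gamma>" and s\<^sub>0: "s\<^sub>0 \<in> S"
begin

interpretation IT: Ionescu_Tulcea "transition S A p \<sigma> s\<^sub>0" "\<lambda>_. M"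
  by (rule Ionescu_Tulcea[OF \<sigma> s\<^sub>0])

lemma process_eq: "process S A p \<sigma> s\<^sub>0 = IT.PF.lim"
  by (simp add: process_def Let_def)

lemma sets_process[measurable_cong]: "sets (process S A p \<sigma> s\<^sub>0) = sets (\<Pi>\<^sub>M i\<in>UNIV. M)"
  by (simp add: process_eq)

lemma space_process: "space (process S A p \<sigma> s\<^sub>0) = space (\<Pi>\<^sub>M i\<in>UNIV. M)"
  by (simp add: process_eq)

lemma process_component: "\<omega> \<in> space (process S A p \<sigma> s\<^sub>0) \<Longrightarrow> \<omega> t \<in> S \<times> A"
  by (auto simp: space_process space_PiM PiE_iff)

lemma prob_space_process: "prob_space (process S A p \<sigma> s\<^sub>0)"
  unfolding process_eq by (rule IT.prob_space_lim)

lemma integral_process: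
  assumes f: "f \<in> borel_measurable M" and B: "\<And>x. x \<in> S \<times> A \<Longrightarrow> \<bar>f x\<bar> \<le> (B::real)"
  shows "(\<integral>\<omega>. f (\<omega> t) \<partial>process S A p \<sigma> s\<^sub>0) =
    (\<integral>\<omega>. (\<integral>x. f x \<partial>transition S A p \<sigma> s\<^sub>0 t (restrict \<omega> {0..<t})) \<partial>process S A p \<sigma> s\<^sub>0)"
  unfolding process_eq using assms by (intro IT.integral_lim_component[where B=B]) auto

lemma restrict_process:
  "\<omega> \<in> space (process S A p \<sigma> s\<^sub>0) \<Longrightarrow> restrict \<omega> {0..<t} \<in> space (\<Pi>\<^sub>M i\<in>{0..<t}. M)"
  using process_component by (auto simp: space_PiM)

lemma integrable_process:
  assumes [measurable]: "f \<in> borel_measurable M" and B: "\<And>x. x \<in> S \<times> A \<Longrightarrow> \<bar>f x\<bar> \<le> (B::real)"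
  shows "integrable (process S A p \<sigma> s\<^sub>0) (\<lambda>\<omega>. f (\<omega> t))"
proof -
  interpret prob_space "process S A p \<sigma> s\<^sub>0" by (rule prob_space_process)
  have "(\<lambda>\<omega>. f (\<omega> t)) \<in> borel_measurable (process S A p \<sigma> s\<^sub>0)"
    by measurable
  then show ?thesis
    by (rule integrable_const_bound[rotated, where B=B]) (use B process_component in auto)
qed

lemma integral_process_bound:
  assumes [measurable]: "f \<in> borel_measurable M" and B: "\<And>x. x \<in> S \<times> A \<Longrightarrow> \<bar>f x\<bar> \<le> (B::real)"
  shows "\<bar>\<integral>\<omega>. f (\<omega> t) \<partial>process S A p \<sigma> s\<^sub>0\<bar> \<le> B"
proof -
  interpret prob_space "process S A p \<sigma> s\<^sub>0" by (rule prob_space_process)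
  have "norm (\<integral>\<omega>. f (\<omega> t) \<partial>process S A p \<sigma> s\<^sub>0) \<le> (\<integral>\<omega>. norm (f (\<omega> t)) \<partial>process S A p \<sigma> s\<^sub>0)"
    by (rule integral_norm_bound)
  also have "\<dots> \<le> (\<integral>\<omega>. B \<partial>process S A p \<sigma> s\<^sub>0)"
    using integrable_process[OF assms] B process_component by (intro integral_mono) auto
  finally show ?thesis by (simp add: prob_space)
qed

text \<open>Positivity is asked only at actions that \<open>\<sigma>\<close> itself chooses, because
  losses may be negative at infeasible actions. Conditioning on the prefix evaluates
  \<open>f\<close> only at such pairs.\<close>

lemma integral_process_nonneg:
  assumes f: "f \<in> borel_measurable M" and B: "\<And>x. x \<in> S \<times> A \<Longrightarrow> \<bar>f x\<bar> \<le> (B::real)"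
    and nn: "\<And>h s. h \<in> space (\<Pi>\<^sub>M i\<in>{0..<t}. M) \<Longrightarrow> s \<in> S \<Longrightarrow> 0 \<le> f (s, \<sigma> t (h, s))"
  shows "0 \<le> (\<integral>\<omega>. f (\<omega> t) \<partial>process S A p \<sigma> s\<^sub>0)"
proof -
  have "0 \<le> (\<integral>x. f x \<partial>transition S A p \<sigma> s\<^sub>0 t (restrict \<omega> {0..<t}))"
    if "\<omega> \<in> space (process S A p \<sigma> s\<^sub>0)" for \<omega>
  proof -
    note h = restrict_process[OF that, of t]
    show ?thesis
      unfolding integral_transition(1)[OF \<sigma> s\<^sub>0 h f]
      by (intro Bochner_Integration.integral_nonneg nn h)
         (simp only: integral_transition(2)[OF \<sigma> s\<^sub>0 h f])
  qed
  then show ?thesis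
    using integral_process[of f B t, OF f B] by (simp add: Bochner_Integration.integral_nonneg)
qed

lemma integral_process_0:
  assumes f: "f \<in> borel_measurable M" and B: "\<And>x. x \<in> S \<times> A \<Longrightarrow> \<bar>f x\<bar> \<le> (B::real)"
  shows "(\<integral>\<omega>. f (\<omega> 0) \<partial>process S A p \<sigma> s\<^sub>0) = f (s\<^sub>0, \<sigma> 0 (\<lambda>_. undefined, s\<^sub>0))"
proof -
  interpret prob_space "process S A p \<sigma> s\<^sub>0" by (rule prob_space_process)
  note [measurable] = f strategyD(1)[OF \<sigma>, of 0]
  \<comment> \<open>The prefix before period 0 is empty; \<open>\<lambda>_. undefined\<close> is the
    only point of the empty product.\<close>
  have [measurable]: "(\<lambda>_. undefined) \<in> space (\<Pi>\<^sub>M i\<in>{0..<0::nat}. M)"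
    by (simp add: space_PiM)
  have "(\<integral>s. f (s, \<sigma> 0 (\<lambda>_. undefined, s)) \<partial>return (borel_on S) s\<^sub>0) = f (s\<^sub>0, \<sigma> 0 (\<lambda>_. undefined, s\<^sub>0))"
    by (rule integral_return) (use s\<^sub>0 in simp, measurable)
  then show ?thesis
    using integral_process[of f B 0, OF f B] integral_transition(1)[OF \<sigma> s\<^sub>0 _ f, of "\<lambda>_. undefined" 0] prob_space
    by (simp add: restrict_def space_PiM)
qed

text \<open>Given the history, the next state is drawn from \<open>p\<close> at the last pair;
  \<open>v\<close> sees only the state, so the action chosen there drops out.\<close>

lemma integral_process_Suc:
  fixes v :: "real^'n \<Rightarrow> real"
  assumes [measurable]: "v \<in> borel_measurable (borel_on S)" and B: "\<And>s. s \<in> S \<Longrightarrow> \<bar>v s\<bar> \<le> B"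
  shows "(\<integral>\<omega>. v (fst (\<omega> (Suc t))) \<partial>process S A p \<sigma> s\<^sub>0) =
    (\<integral>\<omega>. (case \<omega> t of (s, a) \<Rightarrow> \<integral>s'. v s' \<partial>p s a) \<partial>process S A p \<sigma> s\<^sub>0)"
proof -
  have m: "(\<lambda>x. v (fst x)) \<in> borel_measurable M"
    by measurable
  have "(\<integral>\<omega>. v (fst (\<omega> (Suc t))) \<partial>process S A p \<sigma> s\<^sub>0) =
    (\<integral>\<omega>. (\<integral>x. v (fst x) \<partial>transition S A p \<sigma> s\<^sub>0 (Suc t) (restrict \<omega> {0..<Suc t})) \<partial>process S A p \<sigma> s\<^sub>0)"
    by (rule integral_process[OF m, of B]) (use B in auto)
  also have "\<dots> = (\<integral>\<omega>. (case \<omega> t of (s, a) \<Rightarrow> \<integral>s'. v s' \<partial>p s a) \<partial>process S A p \<sigma> s\<^sub>0)"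
    by (rule Bochner_Integration.integral_cong[OF refl])
       (subst integral_transition[OF \<sigma> s\<^sub>0 restrict_process m], auto split: prod.splits)
  finally show ?thesis .
qed

text \<open>The discounted expected continuation values telescope, since the one in period \<open>t + 1\<close> is
  the expectation of its conditional expectation given the pair of period \<open>t\<close>.\<close>
lemma
  assumes v[measurable]: "v \<in> borel_measurable (borel_on S)" and B: "\<And>s. s \<in> S \<Longrightarrow> \<bar>v s\<bar> \<le> B"
  shows payoff_eq: "payoff S A p r \<beta> \<sigma> s\<^sub>0 =
      v s\<^sub>0 - (\<Sum>t. \<beta> ^ t * (\<integral>\<omega>. loss v (\<omega> t) \<partial>process S A p \<sigma> s\<^sub>0))"
    and summable_loss: "summable (\<lambda>t. \<beta> ^ t * (\<integral>\<omega>. loss v (\<omega> t) \<partial>process S A p \<sigma> s\<^sub>0))"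
proof -
  let ?P = "process S A p \<sigma> s\<^sub>0"
  interpret prob_space ?P by (rule prob_space_process)
  define E where "E f t = (\<integral>\<omega>. f (\<omega> t) \<partial>?P)" for f :: "_ \<Rightarrow> real" and t :: nat
  let ?I = "\<lambda>(s, a). \<integral>s'. v s' \<partial>p s a"
  have geo: "summable (\<lambda>t. \<beta> ^ t * C)" for C
    using \<beta> by (intro summable_mult2 summable_geometric) auto
  have sm: "summable (\<lambda>t. \<beta> ^ t * E f t)"
    if "f \<in> borel_measurable M" "\<And>x. x \<in> S \<times> A \<Longrightarrow> \<bar>f x\<bar> \<le> C" for f C
  proof (rule summable_comparison_test'[OF geo])
    show "norm (\<beta> ^ t * E f t) \<le> \<beta> ^ t * C" for t
      using integral_process_bound[OF that, of t] \<beta> unfolding E_def by (simp add: abs_mult)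
  qed
  have r: "\<bar>case_prod r x\<bar> \<le> R" if "x \<in> S \<times> A" for x
    using R(2) that by auto
  have vf: "(\<lambda>x. v (fst x)) \<in> borel_measurable M" "\<And>x. x \<in> S \<times> A \<Longrightarrow> \<bar>v (fst x)\<bar> \<le> B"
    using B by auto
  have I: "?I \<in> borel_measurable M" "\<And>x. x \<in> S \<times> A \<Longrightarrow> \<bar>?I x\<bar> \<le> B"
    using integral_p_bound[OF _ _ v B] by (auto intro: integral_p_measurable)
  have sm_v: "summable (\<lambda>t. \<beta> ^ t * E (\<lambda>x. v (fst x)) t)"
    by (rule sm) (use vf in auto)
  have sm_loss: "summable (\<lambda>t. \<beta> ^ t * E (loss v) t)"
    by (rule sm[OF loss_measurable[OF v] loss_bound[OF v B]])
  have "payoff S A p r \<beta> \<sigma> s\<^sub>0 = (\<integral>\<omega>. (\<Sum>t. \<beta> ^ t * case_prod r (\<omega> t)) \<partial>?P)"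
    by (simp add: payoff_def)
  also have "\<dots> = (\<Sum>t. \<integral>\<omega>. \<beta> ^ t * case_prod r (\<omega> t) \<partial>?P)"
  \<comment> \<open>Sum and expectation may be exchanged because the terms are dominated by the
    geometric series of \<open>\<beta> ^ t * R\<close>.\<close>
  proof (rule integral_suminf)
    show int: "integrable ?P (\<lambda>\<omega>. \<beta> ^ t * case_prod r (\<omega> t))" for t
      using integrable_process[OF r_meas r] by simp
    have le: "norm (\<beta> ^ t * case_prod r (\<omega> t)) \<le> \<beta> ^ t * R" if "\<omega> \<in> space ?P" for \<omega> t
      using r[OF process_component[OF that, of t]] \<beta> by (simp add: abs_mult)
    show "AE \<omega> in ?P. summable (\<lambda>t. norm (\<beta> ^ t * case_prod r (\<omega> t)))"
      by (rule AE_I2, rule summable_comparison_test'[OF geo]) (use le in auto)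
    show "summable (\<lambda>t. \<integral>\<omega>. norm (\<beta> ^ t * case_prod r (\<omega> t)) \<partial>?P)"
    proof (rule summable_comparison_test'[OF geo[of R]])
      show "norm (\<integral>\<omega>. norm (\<beta> ^ t * case_prod r (\<omega> t)) \<partial>?P) \<le> \<beta> ^ t * R" for t
      proof -
        have "(\<integral>\<omega>. norm (\<beta> ^ t * case_prod r (\<omega> t)) \<partial>?P) \<le> (\<integral>\<omega>. \<beta> ^ t * R \<partial>?P)"
          using int le by (intro integral_mono) auto
        then show ?thesis
          by (simp add: prob_space Bochner_Integration.integral_nonneg)
      qed
    qed
  qed
  also have "\<dots> = (\<Sum>t. \<beta> ^ t * E (case_prod r) t)"
    by (simp add: E_def)
  \<comment> \<open>Solving the definition of the loss for the payoff leaves a difference of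
    consecutive values of \<open>v\<close> minus a loss.\<close>
  also have "\<dots> = (\<Sum>t. (\<beta> ^ t * E (\<lambda>x. v (fst x)) t - \<beta> ^ Suc t * E (\<lambda>x. v (fst x)) (Suc t)) - \<beta> ^ t * E (loss v) t)"
  proof (intro suminf_cong)
    fix t
    have "loss v = (\<lambda>x. v (fst x) - (case_prod r x + \<beta> * ?I x))"
      by (auto simp: loss_def q_value_def fun_eq_iff)
    then have "E (loss v) t = (\<integral>\<omega>. v (fst (\<omega> t)) - (case_prod r (\<omega> t) + \<beta> * ?I (\<omega> t)) \<partial>?P)"
      by (simp add: E_def)
    also have "\<dots> = E (\<lambda>x. v (fst x)) t - (E (case_prod r) t + \<beta> * E ?I t)"
      unfolding E_def using integrable_process[OF vf] integrable_process[OF I] integrable_process[OF r_meas r]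
      by (simp add: Bochner_Integration.integral_diff Bochner_Integration.integral_add)
    also have "E ?I t = E (\<lambda>x. v (fst x)) (Suc t)"
      unfolding E_def using integral_process_Suc[OF v B] by simp
    finally have Er: "E (case_prod r) t = E (\<lambda>x. v (fst x)) t - \<beta> * E (\<lambda>x. v (fst x)) (Suc t) - E (loss v) t"
      by simp
    show "\<beta> ^ t * E (case_prod r) t = (\<beta> ^ t * E (\<lambda>x. v (fst x)) t - \<beta> ^ Suc t * E (\<lambda>x. v (fst x)) (Suc t)) - \<beta> ^ t * E (loss v) t"
      unfolding Er by (simp add: algebra_simps)
  qed
  also have "\<dots> = (\<Sum>t. \<beta> ^ t * E (\<lambda>x. v (fst x)) t - \<beta> ^ Suc t * E (\<lambda>x. v (fst x)) (Suc t)) - (\<Sum>t. \<beta> ^ t * E (loss v) t)"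
    using sm_v sm_loss summable_Suc_iff[of "\<lambda>t. \<beta> ^ t * E (\<lambda>x. v (fst x)) t"]
    by (intro suminf_diff[symmetric] summable_diff) auto
  \<comment> \<open>The discounted values are summable and so tend to 0; only the term of period 0
    remains, where the state is \<open>s\<^sub>0\<close>.\<close>
  also have "(\<Sum>t. \<beta> ^ t * E (\<lambda>x. v (fst x)) t - \<beta> ^ Suc t * E (\<lambda>x. v (fst x)) (Suc t)) = v s\<^sub>0"
    using telescope_sums'[OF summable_LIMSEQ_zero[OF sm_v]] integral_process_0[of "\<lambda>x. v (fst x)" B, OF vf]
    by (simp add: sums_iff E_def)
  finally show "payoff S A p r \<beta> \<sigma> s\<^sub>0 = v s\<^sub>0 - (\<Sum>t. \<beta> ^ t * (\<integral>\<omega>. loss v (\<omega> t) \<partial>?P))"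
    by (simp add: E_def)
  show "summable (\<lambda>t. \<beta> ^ t * (\<integral>\<omega>. loss v (\<omega> t) \<partial>?P))"
    using sm_loss by (simp add: E_def)
qed

end

section \<open>The Bellman equation\<close>


text \<open>Exactly the continuation values for which the continuity assumption on \<open>p\<close>
  speaks; the Bellman operator maps this class to itself.\<close>

definition admissible :: "(real^'n \<Rightarrow> real) \<Rightarrow> bool" where
  "admissible v \<longleftrightarrow> usc_on S v \<and> bounded (v ` S)"

lemma admissible_measurable: "admissible v \<Longrightarrow> v \<in> borel_measurable (borel_on S)"
  by (auto simp: admissible_def intro: usc_on_borel_measurable)

lemma admissible_bound: "admissible v \<Longrightarrow> \<exists>B. \<forall>s\<in>S. \<bar>v s\<bar> \<le> B"
  by (auto simp: admissible_def bounded_iff)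

lemma q_value_usc:
  assumes "admissible v"
  shows "usc_on (S \<times> A) (\<lambda>(s, a). q_value v s a)"
proof -
  have "usc_on (S \<times> A) (\<lambda>x. case_prod r x + \<beta> * (case x of (s, a) \<Rightarrow> \<integral>s'. v s' \<partial>p s a))"
    using assms p_usc \<beta> by (intro usc_on_add usc_on_cmult r_usc) (auto simp: admissible_def)
  then show ?thesis
    by (simp add: q_value_def case_prod_beta')
qed

lemma q_value_usc_action:
  assumes "admissible v" "s \<in> S"
  shows "usc_on (\<Gamma> s) (q_value v s)"
proof -
  have "usc_on (\<Gamma> s) (\<lambda>a. case (s, a) of (s, a) \<Rightarrow> q_value v s a)"
    by (rule usc_on_compose[OF q_value_usc[OF assms(1)]])
       (use assms(2) \<Gamma>_subset in \<open>auto intro!: continuous_intros\<close>)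
  then show ?thesis by simp
qed

lemma q_value_lipschitz:
  assumes v: "v \<in> borel_measurable (borel_on S)" "\<exists>B. \<forall>s\<in>S. \<bar>v s\<bar> \<le> B"
    and w: "w \<in> borel_measurable (borel_on S)" "\<exists>B. \<forall>s\<in>S. \<bar>w s\<bar> \<le> B"
    and le: "\<And>s. s \<in> S \<Longrightarrow> \<bar>v s - w s\<bar> \<le> e" and s: "s \<in> S" "a \<in> A"
  shows "\<bar>q_value v s a - q_value w s a\<bar> \<le> \<beta> * e"
proof -
  have "integrable (p s a) v" "integrable (p s a) w"
    using v w by (auto intro: integrable_p[OF s])
  then have "q_value v s a - q_value w s a = \<beta> * (\<integral>s'. v s' - w s' \<partial>p s a)"
    by (simp add: q_value_def algebra_simps)
  also have "\<bar>\<dots>\<bar> \<le> \<beta> * e"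
    using integral_p_bound[OF s, of "\<lambda>s. v s - w s" e] v(1) w(1) le \<beta> by (simp add: abs_mult)
  finally show ?thesis .
qed

definition bellman :: "(real^'n \<Rightarrow> real) \<Rightarrow> real^'n \<Rightarrow> real" where
  "bellman v s = (SUP a\<in>\<Gamma> s. q_value v s a)"

lemma bellman_attained:
  assumes "admissible v" "s \<in> S"
  obtains a where "a \<in> \<Gamma> s" "bellman v s = q_value v s a" "\<And>b. b \<in> \<Gamma> s \<Longrightarrow> q_value v s b \<le> bellman v s"
proof -
  obtain a where a: "a \<in> \<Gamma> s" "\<And>b. b \<in> \<Gamma> s \<Longrightarrow> q_value v s b \<le> q_value v s a"
    using usc_on_compact_attains_sup[OF q_value_usc_action[OF assms] \<Gamma>_compact \<Gamma>_nonempty] assms(2) by blast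
  then have "bellman v s = q_value v s a"
    unfolding bellman_def by (intro cSup_eq_maximum) auto
  with a show thesis by (intro that) auto
qed

lemma bellman_ge:
  assumes "admissible v" "s \<in> S" "a \<in> \<Gamma> s"
  shows "q_value v s a \<le> bellman v s"
  using bellman_attained[OF assms(1,2)] assms(3) by metis

text \<open>The pairs whose action lies outside \<open>F\<close> or has value below \<open>c\<close>
  form a relatively open set, so the tube argument applies. \<open>F = UNIV\<close> yields upper
  semicontinuity of \<open>bellman v\<close>; general \<open>F\<close> serves the measurable choice
  of maximizers.\<close>

lemma openin_q_value_less:
  assumes v: "admissible v" and F: "closed F"
  shows "openin (top_of_set S) {s \<in> S. \<forall>a\<in>\<Gamma> s \<inter> F. q_value v s a < c}"
proof -
  let ?W = "{x \<in> S \<times> A. (case x of (s, a) \<Rightarrow> q_value v s a) < c} \<union> S \<times> A \<inter> (UNIV \<times> - F)"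
  have "openin (top_of_set (S \<times> A)) (S \<times> A \<inter> (UNIV \<times> - F))"
    using F by (intro openin_open_Int open_Times) auto
  then have "openin (top_of_set (S \<times> A)) ?W"
    by (intro openin_Un usc_onD q_value_usc v)
  from openin_usc_correspondence[OF \<Gamma>_usc \<Gamma>_compact \<Gamma>_subset this]
  have "openin (top_of_set S) {s \<in> S. {s} \<times> \<Gamma> s \<subseteq> ?W}" .
  also have "{s \<in> S. {s} \<times> \<Gamma> s \<subseteq> ?W} = {s \<in> S. \<forall>a\<in>\<Gamma> s \<inter> F. q_value v s a < c}"
  proof (rule Collect_cong, rule conj_cong[OF refl])
    fix s assume "s \<in> S"
    then show "{s} \<times> \<Gamma> s \<subseteq> ?W \<longleftrightarrow> (\<forall>a\<in>\<Gamma> s \<inter> F. q_value v s a < c)"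
      using \<Gamma>_subset[of s] by auto
  qed
  finally show ?thesis .
qed

lemma admissible_bellman:
  assumes v: "admissible v"
  shows "admissible (bellman v)"
proof -
  \<comment> \<open>Strictness is kept because the supremum over \<open>\<Gamma> s\<close> is
    attained.\<close>
  have "{s \<in> S. bellman v s < c} = {s \<in> S. \<forall>a\<in>\<Gamma> s \<inter> UNIV. q_value v s a < c}" for c
  proof (rule Collect_cong, rule conj_cong[OF refl])
    fix s assume s: "s \<in> S"
    show "bellman v s < c \<longleftrightarrow> (\<forall>a\<in>\<Gamma> s \<inter> UNIV. q_value v s a < c)"
      by (rule bellman_attained[OF v s]) (auto intro: le_less_trans)
  qed
  then have "usc_on S (bellman v)"
    using openin_q_value_less[OF v closed_UNIV] by (simp add: usc_on_def)
  moreover obtain B where B: "\<And>s. s \<in> S \<Longrightarrow> \<bar>v s\<bar> \<le> B"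
    using admissible_bound[OF v] by blast
  have "\<bar>bellman v s\<bar> \<le> R + \<beta> * B" if "s \<in> S" for s
    by (rule bellman_attained[OF v that])
       (use q_value_bound[OF admissible_measurable[OF v] B that] \<Gamma>_subset[OF that] in auto)
  then have "bounded (bellman v ` S)"
    by (auto simp: bounded_iff)
  ultimately show ?thesis by (simp add: admissible_def)
qed

text \<open>A maximizer for one function is a candidate for the other, so the bound at single
  actions carries over to the maxima.\<close>

lemma bellman_contraction:
  assumes v: "admissible v" and w: "admissible w"
    and le: "\<And>s. s \<in> S \<Longrightarrow> \<bar>v s - w s\<bar> \<le> e" and s: "s \<in> S"
  shows "\<bar>bellman v s - bellman w s\<bar> \<le> \<beta> * e"
proof -
  obtain a where a: "a \<in> \<Gamma> s" "bellman v s = q_value v s a"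
    using bellman_attained[OF v s] by metis
  obtain b where b: "b \<in> \<Gamma> s" "bellman w s = q_value w s b"
    using bellman_attained[OF w s] by metis
  have "\<bar>q_value v s x - q_value w s x\<bar> \<le> \<beta> * e" if "x \<in> \<Gamma> s" for x
    using v w le s \<Gamma>_subset[OF s] that
    by (intro q_value_lipschitz admissible_measurable admissible_bound) auto
  from this[OF a(1)] this[OF b(1)] show ?thesis
    using bellman_ge[OF w s a(1)] bellman_ge[OF v s b(1)] a(2) b(2) by linarith
qed

section \<open>Value iteration and the fixed point\<close>

text \<open>The start 0 is admissible, monotone and, on convex \<open>S\<close>, concave, which
  settles the base cases of the inductions for these properties.\<close>

primrec iterate :: "nat \<Rightarrow> real^'n \<Rightarrow> real" where
  "iterate 0 = (\<lambda>_. 0)"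
| "iterate (Suc n) = bellman (iterate n)"

lemma admissible_iterate: "admissible (iterate n)"
proof (induction n)
  case 0
  show ?case by (auto simp: admissible_def usc_on_const bounded_iff)
qed (simp add: admissible_bellman)

lemma iterate_diff: "s \<in> S \<Longrightarrow> \<bar>iterate (Suc n) s - iterate n s\<bar> \<le> \<beta> ^ n * R"
proof (induction n arbitrary: s)
  case 0
  show ?case
    by (rule bellman_attained[OF admissible_iterate[of 0] 0])
       (use q_value_bound[of "\<lambda>_. 0" 0, OF _ _ 0] \<Gamma>_subset[OF 0] in auto)
next
  case (Suc n)
  show ?case
    using bellman_contraction[OF admissible_iterate admissible_iterate Suc.IH Suc.prems] by (simp add: mult.assoc)
qed

text \<open>Writing the limit as a telescoping series lets the geometric bound on the increments
  give uniform convergence by the Weierstrass test.\<close>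

definition fix_value :: "real^'n \<Rightarrow> real" where
  "fix_value s = (\<Sum>n. iterate (Suc n) s - iterate n s)"

lemma iterate_uniform_limit: "uniform_limit S iterate fix_value sequentially"
proof -
  have "summable (\<lambda>n. \<beta> ^ n * R)"
    using \<beta> by (intro summable_mult2 summable_geometric) auto
  then have "uniform_limit S (\<lambda>n s. \<Sum>i<n. iterate (Suc i) s - iterate i s) fix_value sequentially"
    unfolding fix_value_def using iterate_diff by (intro Weierstrass_m_test) auto
  moreover have "(\<lambda>n s. \<Sum>i<n. iterate (Suc i) s - iterate i s) = iterate"
    by (intro ext) (simp add: sum_lessThan_telescope[of "\<lambda>i. iterate i _"] del: iterate.simps(2))
  ultimately show ?thesis by simp
qed

lemma iterate_tendsto: "s \<in> S \<Longrightarrow> (\<lambda>n. iterate n s) \<longlonglongrightarrow> fix_value s"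
  by (rule tendsto_uniform_limitI[OF iterate_uniform_limit])

lemma admissible_fix_value: "admissible fix_value"
proof -
  obtain n where n: "\<And>s. s \<in> S \<Longrightarrow> \<bar>iterate n s - fix_value s\<bar> < 1"
    using iterate_uniform_limit unfolding uniform_limit_iff dist_real_def eventually_sequentially
    by (metis order_refl zero_less_one)
  obtain B where B: "\<And>s. s \<in> S \<Longrightarrow> \<bar>iterate n s\<bar> \<le> B"
    using admissible_bound[OF admissible_iterate] by blast
  have "\<bar>fix_value s\<bar> \<le> B + 1" if "s \<in> S" for s
    using n[OF that] B[OF that] by linarith
  then show ?thesis
    using usc_on_uniform_limit[OF _ iterate_uniform_limit] admissible_iterate
    by (auto simp: admissible_def bounded_iff)
qed

lemma fix_value_eq:
  assumes s: "s \<in> S"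
  shows "bellman fix_value s = fix_value s"
proof -
  have "(\<lambda>n. iterate (Suc n) s) \<longlonglongrightarrow> bellman fix_value s"
  proof (rule LIMSEQ_I)
    fix e :: real assume "e > 0"
    then have "\<forall>\<^sub>F n in sequentially. \<forall>s\<in>S. dist (iterate n s) (fix_value s) < e"
      using iterate_uniform_limit unfolding uniform_limit_iff by blast
    \<comment> \<open>\<open>N\<close> must be uniform over \<open>S\<close>: the contraction
      controls a Bellman value at one state through the distance over all states.\<close>
    then obtain N where N: "\<And>n s. n \<ge> N \<Longrightarrow> s \<in> S \<Longrightarrow> \<bar>iterate n s - fix_value s\<bar> < e"
      unfolding eventually_sequentially dist_real_def by blast
    have "norm (iterate (Suc n) s - bellman fix_value s) < e" if "n \<ge> N" for n
    proof -
      have "\<bar>bellman (iterate n) s - bellman fix_value s\<bar> \<le> \<beta> * e"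
        using N[OF that] by (intro bellman_contraction admissible_iterate admissible_fix_value s) (simp add: less_imp_le)
      also have "\<dots> < 1 * e"
        using \<beta> \<open>e > 0\<close> by (intro mult_strict_right_mono) auto
      finally show ?thesis by simp
    qed
    then show "\<exists>no. \<forall>n\<ge>no. norm (iterate (Suc n) s - bellman fix_value s) < e" by blast
  qed
  then show ?thesis
    using LIMSEQ_Suc[OF iterate_tendsto[OF s]] LIMSEQ_unique by blast
qed

section \<open>Maximizers in the Bellman equation and their measurable choice\<close>

abbreviation "Q \<equiv> q_value fix_value"

lemma Q_le: "s \<in> S \<Longrightarrow> a \<in> \<Gamma> s \<Longrightarrow> Q s a \<le> fix_value s"
  using bellman_ge[OF admissible_fix_value] fix_value_eq by force

lemma Q_attained: "s \<in> S \<Longrightarrow> \<exists>a\<in>\<Gamma> s. Q s a = fix_value s"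
  by (rule bellman_attained[OF admissible_fix_value, of s]) (auto simp: fix_value_eq)

lemma fix_value_bound: "\<exists>B. \<forall>s\<in>S. \<bar>fix_value s\<bar> \<le> B"
  and fix_value_measurable: "fix_value \<in> borel_measurable (borel_on S)"
  using admissible_fix_value by (auto intro: admissible_bound admissible_measurable)

text \<open>Since \<open>Q\<close> never exceeds \<open>fix_value\<close> on feasible actions, the
  maximizers are the complement in \<open>\<Gamma> s\<close> of a relatively open sublevel
  set.\<close>

lemma maximizers_compact:
  assumes s: "s \<in> S"
  shows "compact {a \<in> \<Gamma> s. Q s a = fix_value s}"
proof -
  have "closedin (top_of_set (\<Gamma> s)) (\<Gamma> s - {a \<in> \<Gamma> s. Q s a < fix_value s})"
    using usc_onD[OF q_value_usc_action[OF admissible_fix_value s]] by (intro closedin_diff) auto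
  moreover have "\<Gamma> s - {a \<in> \<Gamma> s. Q s a < fix_value s} = {a \<in> \<Gamma> s. Q s a = fix_value s}"
    using Q_le[OF s] by (auto simp: not_less intro: antisym)
  ultimately show ?thesis
    using \<Gamma>_compact[OF s] by (auto intro: closedin_compact)
qed

text \<open>No maximizer lies in \<open>F\<close> iff some rational
  \<open>q \<le> fix_value s\<close> bounds \<open>Q s\<close> strictly from above on
  \<open>\<Gamma> s \<inter> F\<close>. The bound is an open condition on \<open>s\<close>, and
  comparing \<open>q\<close> with \<open>fix_value s\<close> is a Borel one, so the complement is a
  countable union of Borel sets.\<close>

lemma maximizers_measurable:
  assumes F: "closed F"
  shows "{s \<in> S. {a \<in> \<Gamma> s. Q s a = fix_value s} \<inter> F \<noteq> {}} \<in> sets (borel_on S)"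
proof -
  define L where "L q = {s \<in> S. \<forall>a\<in>\<Gamma> s \<inter> F. Q s a < real_of_rat q}" for q
  have "(\<forall>a\<in>\<Gamma> s \<inter> F. Q s a < fix_value s) \<longleftrightarrow> (\<exists>q. real_of_rat q \<le> fix_value s \<and> s \<in> L q)" if s: "s \<in> S" for s
  proof
    assume less: "\<forall>a\<in>\<Gamma> s \<inter> F. Q s a < fix_value s"
    \<comment> \<open>\<open>Q s\<close> attains its maximum on the compact set
      \<open>\<Gamma> s \<inter> F\<close>, which leaves a gap for a rational; if the set is empty,
      any smaller number does.\<close>
    have "\<exists>c<fix_value s. \<forall>a\<in>\<Gamma> s \<inter> F. Q s a \<le> c"
    proof (cases "\<Gamma> s \<inter> F = {}")
      case True
      then show ?thesis by (auto intro: exI[of _ "fix_value s - 1"])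
    next
      case False
      have "usc_on (\<Gamma> s \<inter> F) (Q s)"
        using usc_on_subset[OF q_value_usc_action[OF admissible_fix_value s]] by simp
      from usc_on_compact_attains_sup[OF this compact_Int_closed[OF \<Gamma>_compact[OF s] F] False]
      show ?thesis using less by blast
    qed
    then obtain c where c: "c < fix_value s" "\<And>a. a \<in> \<Gamma> s \<inter> F \<Longrightarrow> Q s a \<le> c"
      by blast
    obtain q where q: "c < real_of_rat q" "real_of_rat q < fix_value s"
      using of_rat_dense[OF c(1)] by blast
    then have "s \<in> L q"
      using s c(2) unfolding L_def by fastforce
    with q(2) show "\<exists>q. real_of_rat q \<le> fix_value s \<and> s \<in> L q"
      by (auto intro: less_imp_le)
  next
    assume "\<exists>q. real_of_rat q \<le> fix_value s \<and> s \<in> L q"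
    then show "\<forall>a\<in>\<Gamma> s \<inter> F. Q s a < fix_value s"
      unfolding L_def by (auto intro: less_le_trans)
  qed
  moreover have "{a \<in> \<Gamma> s. Q s a = fix_value s} \<inter> F = {} \<longleftrightarrow> (\<forall>a\<in>\<Gamma> s \<inter> F. Q s a < fix_value s)"
    if "s \<in> S" for s
    using Q_le[OF that] by (auto simp: less_le)
  ultimately have eq: "{a \<in> \<Gamma> s. Q s a = fix_value s} \<inter> F \<noteq> {} \<longleftrightarrow>
      \<not> (\<exists>q. real_of_rat q \<le> fix_value s \<and> s \<in> L q)" if "s \<in> S" for s
    using that by simp
  have [measurable]: "L q \<in> sets (borel_on S)" for q
    using openin_q_value_less[OF admissible_fix_value F, of "real_of_rat q"]
    by (auto simp: L_def openin_open sets_restrict_space)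
  note [measurable] = fix_value_measurable
  have "{s \<in> S. {a \<in> \<Gamma> s. Q s a = fix_value s} \<inter> F \<noteq> {}} =
      space (borel_on S) - (\<Union>q. {s \<in> space (borel_on S). real_of_rat q \<le> fix_value s} \<inter> L q)"
    using eq by auto
  also have "\<dots> \<in> sets (borel_on S)"
    by measurable
  finally show ?thesis .
qed

lemma optimal_selector:
  obtains d where "d \<in> policies S A \<Gamma>" "\<And>s. s \<in> S \<Longrightarrow> Q s (d s) = fix_value s"
proof -
  have nonempty: "{a \<in> \<Gamma> s. Q s a = fix_value s} \<noteq> {}" if "s \<in> S" for s
    using Q_attained[OF that] by blast
  obtain d where d: "d \<in> borel_measurable (borel_on S)" "\<And>s. s \<in> S \<Longrightarrow> d s \<in> {a \<in> \<Gamma> s. Q s a = fix_value s}"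
    by (rule compact_measurable_selection[of "borel_on S" "\<lambda>s. {a \<in> \<Gamma> s. Q s a = fix_value s}"])
       (simp_all only: space_MS maximizers_compact maximizers_measurable nonempty not_False_eq_True)
  have "d \<in> borel_on S \<rightarrow>\<^sub>M borel_on A"
    using d \<Gamma>_subset by (intro measurable_restrict_space2) auto
  then have "restrict d S \<in> borel_on S \<rightarrow>\<^sub>M borel_on A"
    by (subst measurable_cong[where g=d]) auto
  then have "restrict d S \<in> policies S A \<Gamma>"
    using d(2) by (auto simp: policies_def)
  then show thesis
    by (rule that) (use d(2) in auto)
qed

section \<open>The value function and optimal policies\<close>

lemma stationary_strategy:
  assumes d: "d \<in> policies S A \<Gamma>"
  shows "(\<lambda>t (h, s). d s) \<in> strategies S A \<Gamma>"
  using d unfolding strategies_def policies_def by (auto simp: case_prod_beta')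

lemma loss_fix_value_bound: "\<exists>B. \<forall>x\<in>S \<times> A. \<bar>loss fix_value x\<bar> \<le> B"
proof -
  obtain B where "\<And>s. s \<in> S \<Longrightarrow> \<bar>fix_value s\<bar> \<le> B"
    using fix_value_bound by blast
  from loss_bound[OF fix_value_measurable this] show ?thesis by blast
qed

lemma expected_loss_nonneg:
  assumes \<sigma>: "\<sigma> \<in> strategies S A \<Gamma>" and s: "s \<in> S"
  shows "0 \<le> (\<integral>\<omega>. loss fix_value (\<omega> t) \<partial>process S A p \<sigma> s)"
proof -
  obtain B where B: "\<And>x. x \<in> S \<times> A \<Longrightarrow> \<bar>loss fix_value x\<bar> \<le> B"
    using loss_fix_value_bound by blast
  show ?thesis
    by (rule integral_process_nonneg[OF \<sigma> s loss_measurable[OF fix_value_measurable] B])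
       (use strategyD(2)[OF \<sigma>] Q_le in \<open>auto simp: loss_def\<close>)
qed

lemma fix_value_payoff:
  assumes \<sigma>: "\<sigma> \<in> strategies S A \<Gamma>" and s: "s \<in> S"
  shows "payoff S A p r \<beta> \<sigma> s = fix_value s - (\<Sum>t. \<beta> ^ t * (\<integral>\<omega>. loss fix_value (\<omega> t) \<partial>process S A p \<sigma> s))"
    and "summable (\<lambda>t. \<beta> ^ t * (\<integral>\<omega>. loss fix_value (\<omega> t) \<partial>process S A p \<sigma> s))"
proof -
  obtain B where B: "\<And>s. s \<in> S \<Longrightarrow> \<bar>fix_value s\<bar> \<le> B"
    using fix_value_bound by blast
  show "payoff S A p r \<beta> \<sigma> s = fix_value s - (\<Sum>t. \<beta> ^ t * (\<integral>\<omega>. loss fix_value (\<omega> t) \<partial>process S A p \<sigma> s))"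
    by (rule payoff_eq[OF \<sigma> s fix_value_measurable B])
  show "summable (\<lambda>t. \<beta> ^ t * (\<integral>\<omega>. loss fix_value (\<omega> t) \<partial>process S A p \<sigma> s))"
    by (rule summable_loss[OF \<sigma> s fix_value_measurable B])
qed

text \<open>Only the first term of the series of nonnegative losses is kept. The state of period 0
  is \<open>s\<close> itself, so this term is a pointwise loss: a strategy that reaches
  \<open>fix_value s\<close> must choose a maximizer there.\<close>

lemma payoff_le:
  assumes \<sigma>: "\<sigma> \<in> strategies S A \<Gamma>" and s: "s \<in> S"
  shows "payoff S A p r \<beta> \<sigma> s \<le> fix_value s - loss fix_value (s, \<sigma> 0 (\<lambda>_. undefined, s))"
proof -
  obtain B where B: "\<And>x. x \<in> S \<times> A \<Longrightarrow> \<bar>loss fix_value x\<bar> \<le> B"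
    using loss_fix_value_bound by blast
  have 0: "(\<integral>\<omega>. loss fix_value (\<omega> 0) \<partial>process S A p \<sigma> s) = loss fix_value (s, \<sigma> 0 (\<lambda>_. undefined, s))"
    by (rule integral_process_0[OF \<sigma> s loss_measurable[OF fix_value_measurable] B])
  have "(\<Sum>t<1. \<beta> ^ t * (\<integral>\<omega>. loss fix_value (\<omega> t) \<partial>process S A p \<sigma> s))
      \<le> (\<Sum>t. \<beta> ^ t * (\<integral>\<omega>. loss fix_value (\<omega> t) \<partial>process S A p \<sigma> s))"
    using expected_loss_nonneg[OF \<sigma> s] fix_value_payoff(2)[OF \<sigma> s] \<beta> by (intro sum_le_suminf) auto
  then show ?thesis
    using fix_value_payoff(1)[OF \<sigma> s] 0 by simp
qed

text \<open>Positivity applied to both the loss and its negative makes every expected loss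
  zero.\<close>

lemma payoff_selector:
  assumes d: "d \<in> policies S A \<Gamma>" and eq: "\<And>s. s \<in> S \<Longrightarrow> Q s (d s) = fix_value s" and s: "s \<in> S"
  shows "payoff S A p r \<beta> (\<lambda>t (h, s). d s) s = fix_value s"
proof -
  note \<sigma> = stationary_strategy[OF d]
  obtain B where B: "\<And>x. x \<in> S \<times> A \<Longrightarrow> \<bar>- loss fix_value x\<bar> \<le> B"
    using loss_fix_value_bound by auto
  have "(\<lambda>x. - loss fix_value x) \<in> borel_measurable M"
    using loss_measurable[OF fix_value_measurable] by simp
  then have "0 \<le> (\<integral>\<omega>. - loss fix_value (\<omega> t) \<partial>process S A p (\<lambda>t (h, s). d s) s)" for t
    by (rule integral_process_nonneg[OF \<sigma> s _ B]) (simp_all add: loss_def eq)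
  then have "(\<integral>\<omega>. loss fix_value (\<omega> t) \<partial>process S A p (\<lambda>t (h, s). d s) s) = 0" for t
    using expected_loss_nonneg[OF \<sigma> s, of t] by (simp add: antisym)
  then show ?thesis
    using fix_value_payoff(1)[OF \<sigma> s] by simp
qed

lemma value_function_eq:
  assumes s: "s \<in> S"
  shows "value_function S A \<Gamma> p r \<beta> s = fix_value s"
  unfolding value_function_def
proof (rule cSup_eq_maximum)
  obtain d where d: "d \<in> policies S A \<Gamma>" "\<And>s. s \<in> S \<Longrightarrow> Q s (d s) = fix_value s"
    using optimal_selector by blast
  show "fix_value s \<in> (\<lambda>\<sigma>. payoff S A p r \<beta> \<sigma> s) ` strategies S A \<Gamma>"
    using payoff_selector[OF d s] stationary_strategy[OF d(1)] by (metis image_eqI)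
next
  fix x assume "x \<in> (\<lambda>\<sigma>. payoff S A p r \<beta> \<sigma> s) ` strategies S A \<Gamma>"
  then obtain \<sigma> where \<sigma>: "\<sigma> \<in> strategies S A \<Gamma>" and x: "x = payoff S A p r \<beta> \<sigma> s"
    by blast
  have "\<sigma> 0 (\<lambda>_. undefined, s) \<in> \<Gamma> s"
    using s by (intro strategyD(2)[OF \<sigma>]) (auto simp: space_PiM)
  then show "x \<le> fix_value s"
    using payoff_le[OF \<sigma> s] Q_le[OF s] unfolding x loss_def by force
qed

text \<open>For necessity, every state of \<open>S\<close> serves as an initial state, and the loss
  of the first decision must vanish there.\<close>

lemma optimal_policy_iff:
  "optimal_policy S A \<Gamma> p r \<beta> d \<longleftrightarrow> d \<in> policies S A \<Gamma> \<and> (\<forall>s\<in>S. Q s (d s) = fix_value s)"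
proof
  assume opt: "optimal_policy S A \<Gamma> p r \<beta> d"
  then have d: "d \<in> policies S A \<Gamma>"
    and eq: "\<And>s. s \<in> S \<Longrightarrow> payoff S A p r \<beta> (\<lambda>t (h, s). d s) s = fix_value s"
    by (auto simp: optimal_policy_def value_function_eq)
  have "Q s (d s) = fix_value s" if s: "s \<in> S" for s
  proof (rule antisym)
    show "Q s (d s) \<le> fix_value s"
      using d s by (intro Q_le) (auto simp: policies_def)
    show "fix_value s \<le> Q s (d s)"
      using payoff_le[OF stationary_strategy[OF d] s] eq[OF s] by (simp add: loss_def)
  qed
  with d show "d \<in> policies S A \<Gamma> \<and> (\<forall>s\<in>S. Q s (d s) = fix_value s)" by blast
next
  assume "d \<in> policies S A \<Gamma> \<and> (\<forall>s\<in>S. Q s (d s) = fix_value s)"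
  then show "optimal_policy S A \<Gamma> p r \<beta> d"
    using payoff_selector[of d] by (auto simp: optimal_policy_def value_function_eq)
qed

section \<open>Monotonicity, concavity and uniqueness\<close>

lemma admissible_integrable:
  assumes "admissible v" "s \<in> S" "a \<in> A"
  shows "integrable (p s a) v"
  using admissible_bound[OF assms(1)] admissible_measurable[OF assms(1)] integrable_p[OF assms(2,3)]
  by blast

lemmas iterate_integrable = admissible_integrable[OF admissible_iterate]
  and fix_value_integrable = admissible_integrable[OF admissible_fix_value]

text \<open>An action that is best at the lower state stays feasible at the higher one and is worth
  at least as much there; the weak inequality survives the limit of the iterates.\<close>

lemma fix_value_mono:
  assumes r: "\<And>a. a \<in> A \<Longrightarrow> mono_on S (\<lambda>s. r s a)" and p: "kernel_increasing S A p"
    and \<Gamma>: "\<And>s\<^sub>1 s\<^sub>2. s\<^sub>1 \<in> S \<Longrightarrow> s\<^sub>2 \<in> S \<Longrightarrow> s\<^sub>1 \<le> s\<^sub>2 \<Longrightarrow> \<Gamma> s\<^sub>1 \<subseteq> \<Gamma> s\<^sub>2"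
  shows "mono_on S fix_value"
proof -
  have "mono_on S (iterate n)" for n
  proof (induction n)
    case 0
    show ?case by (simp add: monotone_on_def)
  next
    case (Suc n)
    show ?case
    proof (rule mono_onI)
      fix s\<^sub>1 s\<^sub>2 assume s: "s\<^sub>1 \<in> S" "s\<^sub>2 \<in> S" "s\<^sub>1 \<le> s\<^sub>2"
      obtain a where a: "a \<in> \<Gamma> s\<^sub>1" "bellman (iterate n) s\<^sub>1 = q_value (iterate n) s\<^sub>1 a"
        using bellman_attained[OF admissible_iterate s(1)] by metis
      have A: "a \<in> A" "a \<in> \<Gamma> s\<^sub>2"
        using a(1) \<Gamma>_subset[OF s(1)] \<Gamma>[OF s] by auto
      have "mono_on S (\<lambda>s. \<integral>s'. iterate n s' \<partial>p s a)"
        using p Suc.IH A(1) admissible_measurable[OF admissible_iterate] iterate_integrable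
        unfolding kernel_increasing_def by blast
      then have "q_value (iterate n) s\<^sub>1 a \<le> q_value (iterate n) s\<^sub>2 a"
        using r[OF A(1)] s \<beta> unfolding q_value_def monotone_on_def
        by (intro add_mono mult_left_mono) auto
      also have "\<dots> \<le> bellman (iterate n) s\<^sub>2"
        by (rule bellman_ge[OF admissible_iterate s(2) A(2)])
      finally show "iterate (Suc n) s\<^sub>1 \<le> iterate (Suc n) s\<^sub>2"
        using a(2) by simp
    qed
  qed
  then show ?thesis
    by (intro mono_onI LIMSEQ_le[OF iterate_tendsto iterate_tendsto]) (auto simp: monotone_on_def)
qed

lemma q_value_concave:
  assumes "kernel_concave S A p" "concave_on (S \<times> A) (case_prod r)"
    and "v \<in> borel_measurable (borel_on S)" "\<And>s a. s \<in> S \<Longrightarrow> a \<in> A \<Longrightarrow> integrable (p s a) v" "concave_on S v"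
  shows "concave_on (S \<times> A) (case_prod (q_value v))"
proof -
  have "concave_on (S \<times> A) (\<lambda>(s, a). \<integral>s'. v s' \<partial>p s a)"
    using assms unfolding kernel_concave_def by blast
  then have "concave_on (S \<times> A) (\<lambda>x. case_prod r x + \<beta> * (case x of (s, a) \<Rightarrow> \<integral>s'. v s' \<partial>p s a))"
    using \<beta> assms(2) by (intro concave_on_add concave_on_cmul) auto
  then show ?thesis
    by (simp add: q_value_def[abs_def] case_prod_beta')
qed

context
  assumes p: "kernel_concave S A p" and r: "concave_on (S \<times> A) (case_prod r)"
    and S: "convex S" and \<Gamma>: "convex_correspondence S \<Gamma>"
begin

text \<open>The endpoints left out of \<open>convex_correspondence\<close> are added, because
  concavity is checked for all weights in the closed interval.\<close>

lemma \<Gamma>_convex_comb: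
  assumes "s\<^sub>1 \<in> S" "s\<^sub>2 \<in> S" "a\<^sub>1 \<in> \<Gamma> s\<^sub>1" "a\<^sub>2 \<in> \<Gamma> s\<^sub>2" "0 \<le> u" "0 \<le> w" "u + w = 1"
  shows "u *\<^sub>R a\<^sub>1 + w *\<^sub>R a\<^sub>2 \<in> \<Gamma> (u *\<^sub>R s\<^sub>1 + w *\<^sub>R s\<^sub>2)"
proof -
  have w: "w = 1 - u"
    using assms(7) by simp
  consider "u = 0" | "u = 1" | "0 < u" "u < 1"
    using assms(5-7) by linarith
  then show ?thesis
  proof cases
    case 3
    then show ?thesis
      using \<Gamma> assms(1-4) unfolding convex_correspondence_def w by blast
  qed (use assms w in auto)
qed

text \<open>Mixing maximizers of two states gives a feasible action at the mixed state, and joint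
  concavity of the action value bounds its worth from below. Both sides converge pointwise, so the
  limit inherits the inequality.\<close>

lemma fix_value_concave: "concave_on S fix_value"
proof -
  have "concave_on S (iterate n)" for n
  proof (induction n)
    case 0
    show ?case using S by (simp add: concave_on_const)
  next
    case (Suc n)
    let ?q = "q_value (iterate n)"
    have q: "concave_on (S \<times> A) (case_prod ?q)"
      by (intro q_value_concave p r admissible_measurable admissible_iterate iterate_integrable Suc.IH)
    show ?case
      unfolding concave_on_iff
    proof (intro conjI S ballI allI impI)
      fix s\<^sub>1 s\<^sub>2 and u w :: real
      assume s: "s\<^sub>1 \<in> S" "s\<^sub>2 \<in> S" and u: "0 \<le> u" "0 \<le> w" "u + w = 1"
      obtain a\<^sub>1 where a1: "a\<^sub>1 \<in> \<Gamma> s\<^sub>1" "bellman (iterate n) s\<^sub>1 = ?q s\<^sub>1 a\<^sub>1"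
        using bellman_attained[OF admissible_iterate s(1)] by metis
      obtain a\<^sub>2 where a2: "a\<^sub>2 \<in> \<Gamma> s\<^sub>2" "bellman (iterate n) s\<^sub>2 = ?q s\<^sub>2 a\<^sub>2"
        using bellman_attained[OF admissible_iterate s(2)] by metis
      have "(s\<^sub>1, a\<^sub>1) \<in> S \<times> A" "(s\<^sub>2, a\<^sub>2) \<in> S \<times> A"
        using s a1 a2 \<Gamma>_subset by auto
      then have "u * ?q s\<^sub>1 a\<^sub>1 + w * ?q s\<^sub>2 a\<^sub>2 \<le> ?q (u *\<^sub>R s\<^sub>1 + w *\<^sub>R s\<^sub>2) (u *\<^sub>R a\<^sub>1 + w *\<^sub>R a\<^sub>2)"
        using q u unfolding concave_on_iff by fastforce
      also have "\<dots> \<le> bellman (iterate n) (u *\<^sub>R s\<^sub>1 + w *\<^sub>R s\<^sub>2)"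
        using S s u a1 a2 by (intro bellman_ge admissible_iterate \<Gamma>_convex_comb) (auto simp: convex_def)
      finally show "u * iterate (Suc n) s\<^sub>1 + w * iterate (Suc n) s\<^sub>2 \<le> iterate (Suc n) (u *\<^sub>R s\<^sub>1 + w *\<^sub>R s\<^sub>2)"
        using a1(2) a2(2) by simp
    qed
  qed
  then have iter: "u * iterate n x + w * iterate n y \<le> iterate n (u *\<^sub>R x + w *\<^sub>R y)"
    if "x \<in> S" "y \<in> S" "0 \<le> u" "0 \<le> w" "u + w = 1" for n x y u w
    using that unfolding concave_on_iff by blast
  show ?thesis
    unfolding concave_on_iff
  proof (intro conjI S ballI allI impI)
    fix x y and u w :: real
    assume *: "x \<in> S" "y \<in> S" "0 \<le> u" "0 \<le> w" "u + w = 1"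
    have "u *\<^sub>R x + w *\<^sub>R y \<in> S"
      using S * by (auto simp: convex_def)
    then have "(\<lambda>n. iterate n (u *\<^sub>R x + w *\<^sub>R y)) \<longlonglongrightarrow> fix_value (u *\<^sub>R x + w *\<^sub>R y)"
      by (rule iterate_tendsto)
    moreover have "(\<lambda>n. u * iterate n x + w * iterate n y) \<longlonglongrightarrow> u * fix_value x + w * fix_value y"
      using * by (intro tendsto_intros iterate_tendsto)
    ultimately show "u * fix_value x + w * fix_value y \<le> fix_value (u *\<^sub>R x + w *\<^sub>R y)"
      using iter[OF *] by (intro LIMSEQ_le) auto
  qed
qed

text \<open>Two distinct maximizers would have a feasible midpoint. There the payoff lies strictly
  above its average and the expected continuation, concave because \<open>fix_value\<close> is, lies
  at or above its own, so \<open>Q\<close> would exceed its maximum.\<close>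

lemma maximizer_unique:
  assumes strict: "strictly_concave_on A (r s)" and s: "s \<in> S"
    and a: "a \<in> \<Gamma> s" "Q s a = fix_value s" and b: "b \<in> \<Gamma> s" "Q s b = fix_value s"
  shows "a = b"
proof (rule ccontr)
  assume "a \<noteq> b"
  let ?c = "(1/2) *\<^sub>R a + (1/2) *\<^sub>R b" and ?I = "\<lambda>a. \<integral>s'. fix_value s' \<partial>p s a"
  have A: "a \<in> A" "b \<in> A"
    using a b \<Gamma>_subset[OF s] by auto
  \<comment> \<open>Joint concavity and convexity of \<open>\<Gamma>\<close> mix the states as well;
    with both equal to \<open>s\<close>, the mixture has to collapse to \<open>s\<close>.\<close>
  have s_mid: "(1/2) *\<^sub>R s + (1/2) *\<^sub>R s = s"
    by (simp flip: scaleR_left_distrib)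
  have "(1/2) * r s a + (1/2) * r s b < r s ?c"
  proof -
    have "\<forall>x\<in>A. \<forall>y\<in>A. \<forall>u>0. \<forall>v>0. x \<noteq> y \<longrightarrow> u + v = 1 \<longrightarrow> u * r s x + v * r s y < r s (u *\<^sub>R x + v *\<^sub>R y)"
      using strict by (simp add: strictly_concave_on_def)
    from this[rule_format, OF A, of "1/2" "1/2"] show ?thesis
      using \<open>a \<noteq> b\<close> by simp
  qed
  moreover have "(1/2) * ?I a + (1/2) * ?I b \<le> ?I ?c"
  proof -
    have "concave_on (S \<times> A) (\<lambda>(s, a). \<integral>s'. fix_value s' \<partial>p s a)"
      using p fix_value_measurable fix_value_integrable fix_value_concave
      unfolding kernel_concave_def by blast
    then have "\<forall>x\<in>S \<times> A. \<forall>y\<in>S \<times> A. \<forall>u\<ge>0. \<forall>v\<ge>0. u + v = 1 \<longrightarrow>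
        u * (case x of (s, a) \<Rightarrow> \<integral>s'. fix_value s' \<partial>p s a) + v * (case y of (s, a) \<Rightarrow> \<integral>s'. fix_value s' \<partial>p s a)
        \<le> (case u *\<^sub>R x + v *\<^sub>R y of (s, a) \<Rightarrow> \<integral>s'. fix_value s' \<partial>p s a)"
      by (simp add: concave_on_iff)
    from this[rule_format, of "(s, a)" "(s, b)" "1/2" "1/2"] show ?thesis
      using s A s_mid by simp
  qed
  then have "\<beta> * ((1/2) * ?I a + (1/2) * ?I b) \<le> \<beta> * ?I ?c"
    using \<beta> by (intro mult_left_mono) auto
  ultimately have "(1/2) * Q s a + (1/2) * Q s b < Q s ?c"
    unfolding q_value_def by (simp add: algebra_simps)
  moreover have "?c \<in> \<Gamma> s"
    using \<Gamma>_convex_comb[OF s s a(1) b(1), of "1/2" "1/2"] s_mid by simp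
  then have "Q s ?c \<le> fix_value s"
    by (rule Q_le[OF s])
  ultimately show False
    using a(2) b(2) by simp
qed

text \<open>Two optimal policies agree on \<open>S\<close> by uniqueness of the maximizer and off
  \<open>S\<close> by extensionality.\<close>

lemma optimal_policy_unique:
  assumes strict: "\<And>s. s \<in> S \<Longrightarrow> strictly_concave_on A (r s)"
  shows "\<exists>!d. optimal_policy S A \<Gamma> p r \<beta> d"
proof -
  obtain d where d: "d \<in> policies S A \<Gamma>" "\<And>s. s \<in> S \<Longrightarrow> Q s (d s) = fix_value s"
    using optimal_selector by blast
  show ?thesis
  proof (rule ex1I[of _ d])
    show "optimal_policy S A \<Gamma> p r \<beta> d"
      using d by (simp add: optimal_policy_iff)
    fix d' assume "optimal_policy S A \<Gamma> p r \<beta> d'"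
    then have d': "d' \<in> policies S A \<Gamma>" "\<And>s. s \<in> S \<Longrightarrow> Q s (d' s) = fix_value s"
      by (auto simp: optimal_policy_iff)
    show "d' = d"
    proof (rule extensionalityI[of _ S])
      show "d' s = d s" if s: "s \<in> S" for s
        by (rule maximizer_unique[OF strict[OF s] s _ d'(2)[OF s] _ d(2)[OF s]])
           (use d d' s in \<open>auto simp: policies_def\<close>)
    qed (use d d' in \<open>auto simp: policies_def\<close>)
  qed
qed

end

end

theorem theorem3p1:
  fixes S :: "(real^'n) set" and A :: "(real^'k) set"
    and \<Gamma> :: "real^'n \<Rightarrow> (real^'k) set"
    and p :: "real^'n \<Rightarrow> real^'k \<Rightarrow> (real^'n) measure"
    and r :: "real^'n \<Rightarrow> real^'k \<Rightarrow> real" and \<beta> :: real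
  assumes "discounted_dp S A \<Gamma> p r \<beta>"
  shows "((\<forall>a\<in>A. mono_on S (\<lambda>s. r s a)) \<and> kernel_increasing S A p \<and>
            (\<forall>s\<^sub>1\<in>S. \<forall>s\<^sub>2\<in>S. s\<^sub>1 \<le> s\<^sub>2 \<longrightarrow> \<Gamma> s\<^sub>1 \<subseteq> \<Gamma> s\<^sub>2)
          \<longrightarrow> mono_on S (value_function S A \<Gamma> p r \<beta>))
       \<and> (kernel_concave S A p \<and> convex A \<and> concave_on (S \<times> A) (case_prod r) \<and>
            convex S \<and> convex_correspondence S \<Gamma>
          \<longrightarrow> concave_on S (value_function S A \<Gamma> p r \<beta>) \<and>
              ((\<forall>s\<in>S. strictly_concave_on A (r s)) \<longrightarrow> (\<exists>!d. optimal_policy S A \<Gamma> p r \<beta> d)))"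
proof -
  interpret discounted S A \<Gamma> p r \<beta>
    by unfold_locales fact
  \<comment> \<open>\<open>value_function\<close> is identified with \<open>fix_value\<close> only
    on \<open>S\<close>, so both properties are transferred through points of \<open>S\<close>;
    convexity of \<open>S\<close> keeps mixtures there.\<close>
  have "mono_on S (value_function S A \<Gamma> p r \<beta>)" if "mono_on S fix_value"
    using that by (simp add: monotone_on_def value_function_eq)
  moreover have "concave_on S (value_function S A \<Gamma> p r \<beta>)" if "concave_on S fix_value"
    using that unfolding concave_on_iff by (auto simp: value_function_eq convex_def)
  ultimately show ?thesis
    using fix_value_mono fix_value_concave optimal_policy_unique by blast
qed

end
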